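(* Let $X$ be a $1$-dimensional complex submanifold of an open neighbourhood of $a\in\mathbb{C}^m$ with $a\in X$, and let $\Phi=(\Phi_1,\dots,\Phi_m):(\mathbb{C},b)\to(\mathbb{C}^m,a)$ be a local parametrisation of $X$ at $a$. Then for any fixed $d\in\mathbb{N}$ the following three properties are equivalent. (1) $b$ is a bundle point of all the jet spaces of $\mathbb{C}[\Phi]^d$. (2) The exponents of the monomials appearing in $\mathbb{C}[\Phi]^d_b{\downarrow}\subset\mathbb{C}[\tau]$ form a gap-free sequence, i.e. $\mathbb{C}[\Phi]^d_b{\downarrow}$ is closed under $\partial/\partial\tau$ ($a$ is a $D$-invariant point of degree $d$). (3) $a$ is Taylorian of degree $d$, i.e. the $\varphi$-Taylor projector $T_a^{\varphi,d}$ of degree $d$ at $a$ is the same for all local parametrisations of $X$ at $a$.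
   Context: $\mathcal{O}_{1,b}=\mathbb{C}\{t-b\}$ is the ring of germs of holomorphic functions at $b\in\mathbb{C}$; $\mathcal{O}_{X,a}$ is the ring of germs at $a$ of holomorphic functions on $X$; $\tau$ is a dual variable. A local parametrisation of $X$ at $a$ is a holomorphic map germ $\Phi:(\mathbb{C},b)\to(\mathbb{C}^m,a)$ (for some $b\in\mathbb{C}$) inducing a biholomorphic germ $(\mathbb{C},b)\to(X,a)$; $\varphi$ denotes the pull-back $F\mapsto F\circ\Phi$. $\mathbb{C}[x]^d$ is the space of polynomials of degree $\le d$ in $x=(x_1,\dots,x_m)$; $\mathbb{C}[\Phi]^d=\{F\circ\Phi:F\in\mathbb{C}[x]^d\}\subset\mathcal{O}_{1,b}$; $P^d(X_a)\subset\mathcal{O}_{X,a}$ is the space of germs at $a$ of restrictions to $X$ of elements of $\mathbb{C}[x]^d$. Least space: for $0\ne f=\sum_{i\ge k}c_i(t-b)^i$ with $c_k\ne0$, $f_b{\downarrow}=c_k\tau^k$; $0_b{\downarrow}=0$; $\mathbb{C}[\Phi]^d_b{\downarrow}$ is the linear span in $\mathbb{C}[\tau]$ of the $f_b{\downarrow}$, $f\in\mathbb{C}[\Phi]^d$; it is spanned by monomials. Gap-free means that the set of exponents $k$ with $\tau^k\in\mathbb{C}[\Phi]^d_b{\downarrow}$ is of the form $\{0,1,\dots,N\}$. Bundle points: choose representatives of the elements of $Z=\mathbb{C}[\Phi]^d$ on a connected open neighbourhood $W$ of $b$, and for $t\in W$ put $R_k(t)=\{(f^{(i)}(t)/i!)_{0\le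 i\le k}:f\in Z\}$. The point $b$ is a bundle point of all the jet spaces of $Z$ if for every $k\ge0$, $\dim R_k(b)=\max_{t\in W}\dim R_k(t)$ (independent of $W$). Taylor projector: let $S_{1,b}:\mathbb{C}[\tau]\times\mathcal{O}_{1,b}\to\mathbb{C}$, $S_{1,b}\langle\sum a_i\tau^i\,|\,\sum b_j(t-b)^j\rangle=\sum_i i!\,a_i\overline{b_i}$. Its restriction to $\mathbb{C}[\Phi]^d_b{\downarrow}\times\mathbb{C}[\Phi]^d$ is non-degenerate. The $\varphi$-Taylor projector $T_a^{\varphi,d}:\mathcal{O}_{X,a}\to P^d(X_a)$ is the linear map sending $f$ to the unique $p\in P^d(X_a)$ such that $S_{1,b}\langle q\,|\,(f-p)\circ\Phi\rangle=0$ for all $q\in\mathbb{C}[\Phi]^d_b{\downarrow}$. *)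

theory Defs
  imports
    "HOL-Complex_Analysis.Complex_Analysis"
    "HOL-Computational_Algebra.Computational_Algebra"
    "HOL-Library.Function_Algebras"
    "HOL-Library.FuncSet"
begin

section \<open>Holomorphic functions of several variables and complex submanifolds\<close>

(* The library only has holomorphic functions of one variable. A derivative that is
   homogeneous over the complex numbers is complex linear, since has_derivative already
   makes L additive. The definition is only used for open sets S. *)
definition holomorphic_several_on ::
    "((complex, 'm::finite) vec \<Rightarrow> complex) \<Rightarrow> (complex, 'm) vec set \<Rightarrow> bool" where
  "holomorphic_several_on f S \<longleftrightarrow>
     (\<forall>x\<in>S. \<exists>L. (f has_derivative L) (at x) \<and> (\<forall>c v. L (c *s v) = c * L v))"

(* Charts send the points of X to a coordinate subspace of dimension n, that is to
   { z. z_j = 0 for all j outside I } with card I = n. X need not be closed in U. *)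
definition complex_submanifold ::
    "nat \<Rightarrow> (complex, 'm::finite) vec set \<Rightarrow> (complex, 'm) vec set \<Rightarrow> bool" where
  "complex_submanifold n U X \<longleftrightarrow> X \<subseteq> U \<and>
     (\<forall>p\<in>X. \<exists>V (V' :: (complex, 'm) vec set) \<psi> \<theta> I.
        open V \<and> p \<in> V \<and> V \<subseteq> U \<and> open V' \<and> homeomorphism V V' \<psi> \<theta> \<and>
        (\<forall>i. holomorphic_several_on (\<lambda>x. \<psi> x $ i) V) \<and>
        (\<forall>i. holomorphic_several_on (\<lambda>z. \<theta> z $ i) V') \<and>
        card I = n \<and> \<psi> ` (X \<inter> V) = {z\<in>V'. \<forall>j. j \<notin> I \<longrightarrow> z $ j = 0})"

(* A function on a relatively open subset Y of a submanifold is holomorphic iff it is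
   locally the restriction of a holomorphic function on the ambient space. *)
definition holomorphic_on_subset ::
    "((complex, 'm::finite) vec \<Rightarrow> complex) \<Rightarrow> (complex, 'm) vec set \<Rightarrow> bool" where
  "holomorphic_on_subset f Y \<longleftrightarrow>
     (\<forall>p\<in>Y. \<exists>N G. open N \<and> p \<in> N \<and> holomorphic_several_on G N \<and> (\<forall>x\<in>Y \<inter> N. f x = G x))"

(* \<Phi> is a total function standing for its germ at b: only its values near b matter. *)
definition local_parametrisation ::
    "(complex, 'm::finite) vec set \<Rightarrow> (complex, 'm) vec \<Rightarrow> complex \<Rightarrow>
     (complex \<Rightarrow> (complex, 'm) vec) \<Rightarrow> bool" where
  "local_parametrisation X a b \<Phi> \<longleftrightarrow> \<Phi> b = a \<and>
     (\<exists>W V \<theta>. open W \<and> b \<in> W \<and> open V \<and> a \<in> V \<and>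
        (\<forall>i. (\<lambda>t. \<Phi> t $ i) holomorphic_on W) \<and>
        homeomorphism W (X \<inter> V) \<Phi> \<theta> \<and> holomorphic_on_subset \<theta> (X \<inter> V))"

section \<open>Germs on X\<close>

definition germ ::
    "(complex, 'm::finite) vec set \<Rightarrow> (complex, 'm) vec \<Rightarrow> ((complex, 'm) vec \<Rightarrow> complex) \<Rightarrow>
     ((complex, 'm) vec \<Rightarrow> complex) set" where
  "germ X a f = {g. \<exists>V. open V \<and> a \<in> V \<and> (\<forall>x\<in>X \<inter> V. g x = f x)}"

definition holomorphic_germs ::
    "(complex, 'm::finite) vec set \<Rightarrow> (complex, 'm) vec \<Rightarrow>
     ((complex, 'm) vec \<Rightarrow> complex) set set" where
  "holomorphic_germs X a =
     germ X a ` {f. \<exists>V. open V \<and> a \<in> V \<and> holomorphic_on_subset f (X \<inter> V)}"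

definition polynomials_upto :: "nat \<Rightarrow> ((complex, 'm::finite) vec \<Rightarrow> complex) set" where
  "polynomials_upto d =
     range (\<lambda>c x. \<Sum>\<alpha>\<in>{\<alpha>::'m \<Rightarrow> nat. (\<Sum>i\<in>UNIV. \<alpha> i) \<le> d}. c \<alpha> * (\<Prod>i\<in>UNIV. (x $ i) ^ \<alpha> i))"

definition polynomial_germs ::
    "nat \<Rightarrow> (complex, 'm::finite) vec set \<Rightarrow> (complex, 'm) vec \<Rightarrow>
     ((complex, 'm) vec \<Rightarrow> complex) set set" where
  "polynomial_germs d X a = germ X a ` polynomials_upto d"

(* The elements stand for their germs at the base point b of \<Phi>. *)
definition pullback_polynomials ::
    "nat \<Rightarrow> (complex \<Rightarrow> (complex, 'm::finite) vec) \<Rightarrow> (complex \<Rightarrow> complex) set" where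
  "pullback_polynomials d \<Phi> = (\<lambda>F. F \<circ> \<Phi>) ` polynomials_upto d"

section \<open>The least space\<close>

global_interpretation cpoly: vector_space "smult :: complex \<Rightarrow> complex poly \<Rightarrow> complex poly"
  by unfold_locales (simp_all add: smult_add_left smult_add_right)

definition least_part :: "complex \<Rightarrow> (complex \<Rightarrow> complex) \<Rightarrow> complex poly" where
  "least_part b f =
     (let F = fps_expansion f b
      in if F = 0 then 0 else monom (fps_nth F (subdegree F)) (subdegree F))"

definition least_space :: "complex \<Rightarrow> (complex \<Rightarrow> complex) set \<Rightarrow> complex poly set" where
  "least_space b Z = cpoly.span (least_part b ` Z)"

definition gap_free :: "complex poly set \<Rightarrow> bool" where
  "gap_free L \<longleftrightarrow> (\<exists>N. {k. monom 1 k \<in> L} = {0..N})"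

definition closed_under_derivative :: "complex poly set \<Rightarrow> bool" where
  "closed_under_derivative L \<longleftrightarrow> (\<forall>q\<in>L. pderiv q \<in> L)"

section \<open>Jet spaces and bundle points\<close>

(* Vectors of C^(k+1) are sequences that vanish from index k+1 on. *)
global_interpretation cseq: vector_space "(\<lambda>c v i. c * v i) :: complex \<Rightarrow> (nat \<Rightarrow> complex) \<Rightarrow> nat \<Rightarrow> complex"
  by unfold_locales (auto simp: fun_eq_iff algebra_simps)

definition jet :: "nat \<Rightarrow> (complex \<Rightarrow> complex) \<Rightarrow> complex \<Rightarrow> nat \<Rightarrow> complex" where
  "jet k f t = (\<lambda>i. if i \<le> k then (deriv ^^ i) f t / fact i else 0)"

definition representatives ::
    "(complex \<Rightarrow> complex) set \<Rightarrow> complex \<Rightarrow> complex set \<Rightarrow> (complex \<Rightarrow> complex) set" where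
  "representatives Z b W =
     {g. g holomorphic_on W \<and> (\<exists>f\<in>Z. eventually (\<lambda>t. g t = f t) (nhds b))}"

definition representing_neighbourhood ::
    "(complex \<Rightarrow> complex) set \<Rightarrow> complex \<Rightarrow> complex set \<Rightarrow> bool" where
  "representing_neighbourhood Z b W \<longleftrightarrow> open W \<and> connected W \<and> b \<in> W \<and>
     (\<forall>f\<in>Z. \<exists>g. g holomorphic_on W \<and> eventually (\<lambda>t. g t = f t) (nhds b))"

definition jet_space ::
    "(complex \<Rightarrow> complex) set \<Rightarrow> complex \<Rightarrow> complex set \<Rightarrow> nat \<Rightarrow> complex \<Rightarrow>
     (nat \<Rightarrow> complex) set" where
  "jet_space Z b W k t = (\<lambda>g. jet k g t) ` representatives Z b W"

(* The dimensions are at most k+1, so the maximum is over a finite set. *)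
definition bundle_point ::
    "(complex \<Rightarrow> complex) set \<Rightarrow> complex \<Rightarrow> complex set \<Rightarrow> bool" where
  "bundle_point Z b W \<longleftrightarrow>
     (\<forall>k. cseq.dim (jet_space Z b W k b) = Max ((\<lambda>t. cseq.dim (jet_space Z b W k t)) ` W))"

section \<open>Taylor projectors\<close>

definition taylor_pairing :: "complex \<Rightarrow> complex poly \<Rightarrow> (complex \<Rightarrow> complex) \<Rightarrow> complex" where
  "taylor_pairing b q g =
     (\<Sum>i\<le>degree q. fact i * coeff q i * cnj (fps_nth (fps_expansion g b) i))"

(* A map between sets of germs, extended by undefined outside the germs of holomorphic
   functions, so that equality of projectors is equality of functions. The condition does
   not depend on the representatives f and p, because \<Phi> maps a neighbourhood of b into X. *)
definition taylor_projector ::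
    "(complex, 'm::finite) vec set \<Rightarrow> (complex, 'm) vec \<Rightarrow> nat \<Rightarrow> complex \<Rightarrow>
     (complex \<Rightarrow> (complex, 'm) vec) \<Rightarrow>
     ((complex, 'm) vec \<Rightarrow> complex) set \<Rightarrow> ((complex, 'm) vec \<Rightarrow> complex) set" where
  "taylor_projector X a d b \<Phi> =
     restrict
       (\<lambda>\<gamma>. THE \<pi>. \<pi> \<in> polynomial_germs d X a \<and>
          (\<forall>f\<in>\<gamma>. \<forall>p\<in>\<pi>. \<forall>q\<in>least_space b (pullback_polynomials d \<Phi>).
             taylor_pairing b q (\<lambda>t. f (\<Phi> t) - p (\<Phi> t)) = 0))
       (holomorphic_germs X a)"

definition taylorian ::
    "(complex, 'm::finite) vec set \<Rightarrow> (complex, 'm) vec \<Rightarrow> nat \<Rightarrow> bool" where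
  "taylorian X a d \<longleftrightarrow>
     (\<forall>b \<Phi> b' \<Phi>'. local_parametrisation X a b \<Phi> \<and> local_parametrisation X a b' \<Phi>' \<longrightarrow>
        taylor_projector X a d b \<Phi> = taylor_projector X a d b' \<Phi>')"

end

theory Submission
  imports Defs
begin

text \<open>
  Let \<open>E\<close> be the set of vanishing orders at \<open>b\<close> of the nonzero elements of the pulled back
  polynomials; the least space is spanned by the monomials with exponents in \<open>E\<close>, and a Taylor
  projection prescribes exactly the Taylor coefficients with indices in \<open>E\<close>.
  The \<open>k\<close>-th jet space at \<open>b\<close> has dimension \<open>card (E \<inter> {..k})\<close>, whereas at some point of any
  neighbourhood the orders \<open>0, ..., card E - 1\<close> all occur, so that the maximal dimension is
  \<open>min (k + 1) (card E)\<close>; both agree for all \<open>k\<close> iff \<open>E\<close> has no gap.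
  If \<open>E = {..<n}\<close>, the projector only depends on the condition that \<open>f - p\<close> vanishes to order
  \<open>n\<close>, which does not involve the parametrisation. If \<open>E\<close> has a gap, a quadratic change of the
  parameter alters the projector.
\<close>

section \<open>Taylor expansions at a point\<close>

text \<open>Different polynomials may have the same restriction to X, so monomials give no basis of
  the pulled back space. One element of each order in E does: these elements form a triangular
  system. It yields the finiteness of E and the solvability of interpolation at the indices in E.
  Uniqueness holds because the first nonzero coefficient of an element sits at an index in E.
  Together these are the non-degeneracy of the pairing. A change of parameter is a composition with
  a series without constant term. It mixes a Taylor coefficient with those of lower index, so it
  preserves the vanishing of all coefficients below a bound, hence orders and E itself, but not the
  vanishing of a coefficient after a gap. The point at which all small orders occur could be found
  as a point where a Wronskian does not vanish; the induction by quotients and derivatives reaches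
  it without determinants.\<close>

lemma fps_expansion_eqI_shifted:
  assumes "f analytic_on {z}" "(\<lambda>x. f (z + x)) has_fps_expansion F"
  shows "fps_expansion f z = F"
  using analytic_at_imp_has_fps_expansion[OF assms(1)] assms(2) by (rule fps_expansion_unique_complex)

lemma fps_expansion_add:
  assumes "f analytic_on {z}" "g analytic_on {z}"
  shows "fps_expansion (\<lambda>x. f x + g x) z = fps_expansion f z + fps_expansion g z"
  using assms
  by (intro fps_expansion_eqI_shifted analytic_intros has_fps_expansion_add
      analytic_at_imp_has_fps_expansion)

lemma fps_expansion_diff:
  assumes "f analytic_on {z}" "g analytic_on {z}"
  shows "fps_expansion (\<lambda>x. f x - g x) z = fps_expansion f z - fps_expansion g z"
  using assms
  by (intro fps_expansion_eqI_shifted analytic_intros has_fps_expansion_diff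
      analytic_at_imp_has_fps_expansion)

lemma fps_expansion_mult:
  assumes "f analytic_on {z}" "g analytic_on {z}"
  shows "fps_expansion (\<lambda>x. f x * g x) z = fps_expansion f z * fps_expansion g z"
  using assms
  by (intro fps_expansion_eqI_shifted analytic_intros has_fps_expansion_mult
      analytic_at_imp_has_fps_expansion)

lemma fps_expansion_const [simp]: "fps_expansion (\<lambda>_. c) z = fps_const c"
  by (intro fps_expansion_eqI_shifted) auto

lemma fps_expansion_sum:
  assumes "\<And>i. i \<in> S \<Longrightarrow> f i analytic_on {z}"
  shows "fps_expansion (\<lambda>x. \<Sum>i\<in>S. c i * f i x) z = (\<Sum>i\<in>S. fps_const (c i) * fps_expansion (f i) z)"
  using assms
  by (intro fps_expansion_eqI_shifted analytic_intros has_fps_expansion_sum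
      has_fps_expansion_cmult_left analytic_at_imp_has_fps_expansion) auto

lemma fps_nth_expansion_sum:
  assumes "\<And>i. i \<in> S \<Longrightarrow> f i analytic_on {z}"
  shows "fps_nth (fps_expansion (\<lambda>x. \<Sum>i\<in>S. c i * f i x) z) n =
         (\<Sum>i\<in>S. c i * fps_nth (fps_expansion (f i) z) n)"
  by (subst fps_expansion_sum) (simp_all add: assms fps_sum_nth)

lemma fps_expansion_eq_0_iff:
  assumes "f analytic_on {z}"
  shows "fps_expansion f z = 0 \<longleftrightarrow> (\<forall>\<^sub>F x in nhds z. f x = 0)"
proof
  assume "fps_expansion f z = 0"
  then have "\<forall>\<^sub>F x in nhds 0. f (z + x) = 0"
    using analytic_at_imp_has_fps_expansion[OF assms] by (simp add: has_fps_expansion_0_iff)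
  then show "\<forall>\<^sub>F x in nhds z. f x = 0"
    by (simp add: nhds_to_0[of z] eventually_filtermap add.commute)
next
  assume "\<forall>\<^sub>F x in nhds z. f x = 0"
  then show "fps_expansion f z = 0"
    using fps_expansion_cong[of f "\<lambda>_. 0" z] by simp
qed

lemma fps_nth_expansion_0 [simp]: "fps_nth (fps_expansion f z) 0 = f z"
  by (simp add: fps_expansion_def)

lemma fps_nth_expansion_deriv:
  "fps_nth (fps_expansion (deriv f) z) n = of_nat (Suc n) * fps_nth (fps_expansion f z) (Suc n)"
  using of_nat_neq_0[of n, where ?'a = complex]
  by (simp add: fps_expansion_def funpow_Suc_right del: funpow.simps of_nat_Suc)

lemma fps_expansion_power_shift:
  "fps_expansion (\<lambda>t. (t - z) ^ k) z = fps_X ^ k"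
  by (intro fps_expansion_eqI_shifted analytic_intros)
     (auto intro: has_fps_expansion_fps_X_power)

text \<open>The expansion of the composite is \<open>F oo G\<close> with
  \<open>fps_nth G 0 = 0\<close>, and its i-th coefficient is a combination of the coefficients of F
  with index at most i.\<close>

lemma fps_expansion_compose_vanishing:
  assumes f: "f analytic_on {h z}" and h: "h analytic_on {z}"
    and van: "\<And>i. i < k \<Longrightarrow> fps_nth (fps_expansion f (h z)) i = 0" and "i < k"
  shows "fps_nth (fps_expansion (\<lambda>t. f (h t)) z) i = 0"
proof -
  define F where "F = fps_expansion f (h z)"
  define G where "G = fps_expansion (\<lambda>t. h t - h z) z"
  have F: "(\<lambda>x. f (h z + x)) has_fps_expansion F"
    unfolding F_def using f by (rule analytic_at_imp_has_fps_expansion)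
  have G: "(\<lambda>x. h (z + x) - h z) has_fps_expansion G"
    unfolding G_def using h by (intro analytic_at_imp_has_fps_expansion analytic_intros)
  have G0: "fps_nth G 0 = 0"
    by (simp add: G_def)
  have "((\<lambda>x. f (h z + x)) \<circ> (\<lambda>x. h (z + x) - h z)) has_fps_expansion (F oo G)"
    using F G G0 by (rule has_fps_expansion_compose)
  moreover have "(\<lambda>t. f (h t)) analytic_on {z}"
    using analytic_on_compose[OF h, of f] f by (simp add: o_def)
  ultimately have "fps_expansion (\<lambda>t. f (h t)) z = F oo G"
    by (intro fps_expansion_eqI_shifted) (simp_all add: o_def)
  moreover have "fps_nth (F oo G) i = 0"
    using van \<open>i < k\<close> by (auto simp: fps_compose_nth F_def intro!: sum.neutral)
  ultimately show ?thesis by simp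
qed

lemma holomorphic_zero_germ:
  assumes "g holomorphic_on W" "open W" "connected W" "z \<in> W"
    "\<forall>\<^sub>F x in nhds z. g x = 0" "x \<in> W"
  shows "g x = 0"
proof -
  have "\<forall>\<^sub>F x in nhds z. g x = 0 \<and> x \<in> W"
    using assms eventually_nhds_in_open[of W z] by (auto simp: eventually_conj_iff)
  then obtain B where B: "open B" "z \<in> B" "\<forall>y\<in>B. g y = 0 \<and> y \<in> W"
    unfolding eventually_nhds by blast
  show ?thesis
    by (rule analytic_continuation_open[of B W g "\<lambda>_. 0"]) (use assms B in auto)
qed

lemma sum_fun_apply: "(\<Sum>x\<in>A. f x) i = (\<Sum>x\<in>A. f x i)"
  for f :: "'a \<Rightarrow> 'b \<Rightarrow> 'c::comm_monoid_add"
  by (induction A rule: infinite_finite_induct) auto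

text \<open>The sequences start at distinct positions: in a vanishing combination, the smallest s
  with a nonzero coefficient would leave a nonzero entry at position s. It is applied to Taylor
  coefficients and to jets.\<close>

lemma independent_echelon:
  assumes nz: "\<And>s. s \<in> S \<Longrightarrow> v s s \<noteq> 0" and z: "\<And>s i. s \<in> S \<Longrightarrow> i < s \<Longrightarrow> v s i = 0"
  shows "cseq.independent (v ` S)" "inj_on v S"
proof -
  show inj: "inj_on v S"
  proof (rule inj_onI)
    fix x y assume "x \<in> S" "y \<in> S" "v x = v y"
    then show "x = y" using nz z by (metis linorder_neqE_nat)
  qed
  show "cseq.independent (v ` S)"
  proof
    assume "cseq.dependent (v ` S)"
    then obtain T u where T: "finite T" "T \<subseteq> v ` S" and sum: "(\<Sum>w\<in>T. (\<lambda>i. u w * w i)) = 0"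
      and ex: "\<exists>w\<in>T. u w \<noteq> 0"
      unfolding cseq.dependent_explicit by blast
    define s where "s = (LEAST s. s \<in> S \<and> v s \<in> T \<and> u (v s) \<noteq> 0)"
    have "\<exists>s. s \<in> S \<and> v s \<in> T \<and> u (v s) \<noteq> 0"
      using ex T by auto
    then have s: "s \<in> S" "v s \<in> T" "u (v s) \<noteq> 0"
      unfolding s_def by (metis (mono_tags, lifting) LeastI_ex)+
    have min: "u (v r) = 0" if "r \<in> S" "v r \<in> T" "r < s" for r
      using not_less_Least[of r "\<lambda>s. s \<in> S \<and> v s \<in> T \<and> u (v s) \<noteq> 0"] that s_def by blast
    have "0 = (\<Sum>w\<in>T. u w * w s)"
      using fun_cong[OF sum, of s] by (simp add: sum_fun_apply)
    also have "\<dots> = (\<Sum>w\<in>{v s}. u w * w s)"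
    proof (rule sum.mono_neutral_right)
      show "\<forall>w\<in>T - {v s}. u w * w s = 0"
      proof
        fix w assume w: "w \<in> T - {v s}"
        then obtain r where r: "r \<in> S" "w = v r" using T by auto
        then have "r < s \<or> s < r" using w by (metis DiffD2 insertI1 linorder_neqE_nat)
        then show "u w * w s = 0" using min z r w by auto
      qed
    qed (use T s in auto)
    finally show False using s nz by auto
  qed
qed

section \<open>Points at which all small vanishing orders occur\<close>

text \<open>Phrased by coefficients because \<open>subdegree 0 = 0\<close>: the zero germ must have
  no order at all rather than order 0.\<close>

definition vanishes_exactly :: "nat \<Rightarrow> (complex \<Rightarrow> complex) \<Rightarrow> complex \<Rightarrow> bool" where
  "vanishes_exactly k f t \<longleftrightarrow>
     fps_nth (fps_expansion f t) k \<noteq> 0 \<and> (\<forall>j<k. fps_nth (fps_expansion f t) j = 0)"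

lemma vanishes_exactly_iff_subdegree:
  "vanishes_exactly k f t \<longleftrightarrow> fps_expansion f t \<noteq> 0 \<and> subdegree (fps_expansion f t) = k"
  unfolding vanishes_exactly_def
  by (metis fps_nonzero_nth nth_less_subdegree_zero nth_subdegree_nonzero subdegreeI)

lemma vanishes_exactly_mult:
  assumes "f analytic_on {t}" "g analytic_on {t}" "f t \<noteq> 0" "vanishes_exactly k g t"
  shows "vanishes_exactly k (\<lambda>x. f x * g x) t"
proof -
  have "fps_nth (fps_expansion f t) 0 \<noteq> 0" using assms(3) by simp
  then have "fps_expansion f t \<noteq> 0" "subdegree (fps_expansion f t) = 0"
    by (auto simp del: fps_nth_expansion_0 intro: subdegree_eq_0)
  then show ?thesis
    using assms(4) by (simp add: vanishes_exactly_iff_subdegree fps_expansion_mult[OF assms(1,2)])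
qed

text \<open>Undoes the differentiation in the induction below. The condition \<open>w t = 0\<close>
  supplies the coefficient of index 0, which the derivative does not see.\<close>

lemma vanishes_exactly_antideriv:
  assumes "vanishes_exactly k (deriv w) t" "w t = 0"
  shows "vanishes_exactly (Suc k) w t"
  using assms unfolding vanishes_exactly_def
  by (auto simp: fps_nth_expansion_deriv less_Suc_eq_0_disj simp del: of_nat_Suc)

lemma vanishes_exactly_cong:
  assumes "\<forall>\<^sub>F x in nhds t. f x = g x"
  shows "vanishes_exactly k f t \<longleftrightarrow> vanishes_exactly k g t"
  using fps_expansion_cong[OF assms] by (simp add: vanishes_exactly_def)

text \<open>
  Induction on the number of functions: dividing by one of them where it has no zero and
  differentiating kills that function and lowers all remaining vanishing orders by one.
\<close>
lemma exists_point_all_orders: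
  fixes f :: "'i \<Rightarrow> complex \<Rightarrow> complex"
  assumes "finite S" "open B" "connected B" "B \<noteq> {}"
    and "\<And>i. i \<in> S \<Longrightarrow> f i holomorphic_on B"
    and "\<And>c. (\<forall>x\<in>B. (\<Sum>i\<in>S. c i * f i x) = 0) \<Longrightarrow> \<forall>i\<in>S. c i = 0"
  shows "\<exists>t\<in>B. \<forall>k<card S. \<exists>c. vanishes_exactly k (\<lambda>x. \<Sum>i\<in>S. c i * f i x) t"
  using assms
proof (induction S arbitrary: f B rule: finite_induct)
  case empty
  then show ?case by auto
next
  case (insert a S f B)
  note hol = insert.prems(4) and indep = insert.prems(5)
  have single: "(\<Sum>i\<in>insert a S. (if i = a then 1 else 0) * f i x) = f a x" for x
  proof -
    have "(\<Sum>i\<in>S. (if i = a then 1 else 0) * f i x) = 0"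
      using insert.hyps by (intro sum.neutral) auto
    then show ?thesis using insert.hyps by simp
  qed
  have "\<exists>x\<in>B. f a x \<noteq> 0"
  proof (rule ccontr)
    assume "\<not> ?thesis"
    then have "\<forall>x\<in>B. (\<Sum>i\<in>insert a S. (if i = a then 1 else 0) * f i x) = 0"
      unfolding single by auto
    from indep[OF this] show False by auto
  qed
  then obtain x0 where x0: "x0 \<in> B" "f a x0 \<noteq> 0" by blast
  have cont: "continuous_on B (f a)"
    using hol by (intro holomorphic_on_imp_continuous_on) auto
  have "open {x\<in>B. f a x \<noteq> 0}"
    using continuous_on_open_vimage[OF \<open>open B\<close>, of "f a"] cont open_delete[OF open_UNIV, of 0]
    by (auto dest!: spec[of _ "- {0}"] simp: vimage_def Int_def conj_commute)
  then obtain r where r: "r > 0" "ball x0 r \<subseteq> {x\<in>B. f a x \<noteq> 0}"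
    using x0 by (metis (mono_tags, lifting) mem_Collect_eq openE)
  define B' where "B' = ball x0 r"
  have B': "open B'" "connected B'" "B' \<noteq> {}" "x0 \<in> B'" "B' \<subseteq> B" "\<And>x. x \<in> B' \<Longrightarrow> f a x \<noteq> 0"
    using r by (auto simp: B'_def)
  have holB': "f i holomorphic_on B'" if "i \<in> insert a S" for i
    using hol[OF that] B'(5) by (rule holomorphic_on_subset)
  define u where "u c x = (\<Sum>i\<in>S. c i * (f i x / f a x))" for c x
  define g where "g i = deriv (\<lambda>x. f i x / f a x)" for i
  have holq: "(\<lambda>x. f i x / f a x) holomorphic_on B'" if "i \<in> S" for i
    using that B'(6) by (intro holomorphic_intros holB') auto
  have holg: "g i holomorphic_on B'" if "i \<in> S" for i
    unfolding g_def using holq[OF that] B'(1) by (rule holomorphic_deriv)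
  have u_deriv: "(u c has_field_derivative (\<Sum>i\<in>S. c i * g i x)) (at x)" if "x \<in> B'" for c x
    unfolding u_def g_def
    by (intro DERIV_sum DERIV_cmult holomorphic_derivI[OF holq B'(1) that])
  have u_eq: "f a x * u c x = (\<Sum>i\<in>S. c i * f i x)" if "x \<in> B'" for c x
    unfolding u_def sum_distrib_left using B'(6)[OF that] by (intro sum.cong) auto
  have "\<exists>t\<in>B'. \<forall>k<card S. \<exists>c. vanishes_exactly k (\<lambda>x. \<Sum>i\<in>S. c i * g i x) t"
  proof (rule insert.IH)
    fix c assume c: "\<forall>x\<in>B'. (\<Sum>i\<in>S. c i * g i x) = 0"
    have "continuous_on B' (u c)"
      using u_deriv by (meson DERIV_isCont continuous_at_imp_continuous_on)
    moreover have "\<forall>x\<in>B' - {}. (u c has_field_derivative 0) (at x)"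
      using u_deriv c by (metis Diff_empty)
    ultimately obtain C where C: "\<And>x. x \<in> B' \<Longrightarrow> u c x = C"
      using DERIV_zero_connected_constant[OF B'(2,1) finite.emptyI] by metis
    \<comment> \<open>A relation among the derivatives integrates to a constant value C of
      \<open>u c\<close>. Multiplied by \<open>f a\<close>, this is a relation among the original
      functions on \<open>B'\<close> with coefficient -C at a, and it extends to B by analytic
      continuation.\<close>
    define c' where "c' i = (if i = a then - C else c i)" for i
    have "(\<Sum>i\<in>insert a S. c' i * f i x) = (\<Sum>i\<in>S. c i * f i x) - C * f a x" for x
    proof -
      have "(\<Sum>i\<in>S. c' i * f i x) = (\<Sum>i\<in>S. c i * f i x)"
        using insert.hyps by (intro sum.cong) (auto simp: c'_def)
      then show ?thesis using insert.hyps by (simp add: c'_def)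
    qed
    then have zero: "(\<Sum>i\<in>insert a S. c' i * f i x) = 0" if "x \<in> B'" for x
      using u_eq[OF that, of c] C[OF that] by (simp add: mult.commute)
    have "(\<Sum>i\<in>insert a S. c' i * f i x) = 0" if "x \<in> B" for x
    proof (rule analytic_continuation_open[of B' B "\<lambda>x. \<Sum>i\<in>insert a S. c' i * f i x" "\<lambda>_. 0"])
      show "(\<lambda>x. \<Sum>i\<in>insert a S. c' i * f i x) holomorphic_on B"
        using hol by (intro holomorphic_intros) auto
    qed (use B' insert.prems zero that in auto)
    then have "\<forall>i\<in>insert a S. c' i = 0"
      by (intro indep) auto
    then show "\<forall>i\<in>S. c i = 0"
      using insert.hyps unfolding c'_def by (metis insertCI)
  qed (use B' holg in auto)
  then obtain t where t: "t \<in> B'"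
    and tk: "\<And>k. k < card S \<Longrightarrow> \<exists>c. vanishes_exactly k (\<lambda>x. \<Sum>i\<in>S. c i * g i x) t"
    by blast
  have near: "\<forall>\<^sub>F x in nhds t. x \<in> B'"
    using B'(1) t by (rule eventually_nhds_in_open)
  have ana_fa: "f a analytic_on {t}"
    using holB'[of a] B'(1) t by (auto simp: analytic_at)
  have "\<exists>c. vanishes_exactly k (\<lambda>x. \<Sum>i\<in>insert a S. c i * f i x) t" if k: "k < card (insert a S)" for k
  proof (cases k)
    case 0
    have "vanishes_exactly 0 (f a) t"
      using B'(6)[OF t] by (simp add: vanishes_exactly_def)
    then show ?thesis
      unfolding 0 by (intro exI[of _ "\<lambda>i. if i = a then 1 else 0"]) (simp only: single)
  next
    case (Suc j)
    then obtain c where c: "vanishes_exactly j (\<lambda>x. \<Sum>i\<in>S. c i * g i x) t"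
      using tk[of j] k insert.hyps by auto
    \<comment> \<open>Among the antiderivatives, this one vanishes at t, so its order is j + 1.
      Multiplication by \<open>f a\<close>, which is nonzero at t, keeps the order and gives a
      combination of the original functions, with coefficient \<open>- u c t\<close> at a.\<close>
    define w where "w x = u c x - u c t" for x
    have w_deriv: "(w has_field_derivative (\<Sum>i\<in>S. c i * g i x)) (at x)" if "x \<in> B'" for x
      unfolding w_def using DERIV_diff[OF u_deriv[OF that, of c] DERIV_const[of "u c t"]] by simp
    have "\<forall>\<^sub>F x in nhds t. deriv w x = (\<Sum>i\<in>S. c i * g i x)"
      using near by eventually_elim (use w_deriv DERIV_imp_deriv in blast)
    then have "vanishes_exactly j (deriv w) t"
      using c by (simp add: vanishes_exactly_cong)
    then have w_order: "vanishes_exactly (Suc j) w t"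
      by (rule vanishes_exactly_antideriv) (simp add: w_def)
    have "w holomorphic_on B'"
      using w_deriv B'(1) holomorphic_on_open by blast
    then have "w analytic_on {t}"
      using B'(1) t by (auto simp: analytic_at)
    then have fw: "vanishes_exactly k (\<lambda>x. f a x * w x) t"
      unfolding Suc using ana_fa B'(6)[OF t] w_order by (intro vanishes_exactly_mult)
    define c' where "c' i = (if i = a then - u c t else c i)" for i
    have sum_c': "(\<Sum>i\<in>insert a S. c' i * f i x) = (\<Sum>i\<in>S. c i * f i x) - u c t * f a x" for x
    proof -
      have "(\<Sum>i\<in>S. c' i * f i x) = (\<Sum>i\<in>S. c i * f i x)"
        using insert.hyps by (intro sum.cong) (auto simp: c'_def)
      then show ?thesis using insert.hyps by (simp add: c'_def)
    qed
    have "\<forall>\<^sub>F x in nhds t. f a x * w x = (\<Sum>i\<in>insert a S. c' i * f i x)"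
      using near
    proof eventually_elim
      case (elim x)
      then show ?case
        unfolding sum_c' using u_eq[of x c] by (simp add: w_def algebra_simps)
    qed
    then have "vanishes_exactly k (\<lambda>x. \<Sum>i\<in>insert a S. c' i * f i x) t"
      using fw by (rule vanishes_exactly_cong[THEN iffD1])
    then show ?thesis by blast
  qed
  then show ?case using t B'(5) by blast
qed

section \<open>Finite-dimensional spaces of germs\<close>

text \<open>The properties of the pulled back polynomials on which the one-variable part rests. The
  constant 1 has order 0, so the set of exponents is nonempty, as the form {0..N} of a gap-free set
  demands.\<close>

locale germ_space =
  fixes Z :: "(complex \<Rightarrow> complex) set" and b :: complex
  assumes analytic: "f \<in> Z \<Longrightarrow> f analytic_on {b}"
    and one: "(\<lambda>_. 1) \<in> Z"
    and closed: "f \<in> Z \<Longrightarrow> g \<in> Z \<Longrightarrow> (\<lambda>t. f t + c * g t) \<in> Z"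
    and finite_span: "\<exists>B. finite B \<and> B \<subseteq> Z \<and> (\<forall>f\<in>Z. \<exists>c. f = (\<lambda>t. \<Sum>g\<in>B. c g * g t))"
begin

abbreviation coef :: "(complex \<Rightarrow> complex) \<Rightarrow> nat \<Rightarrow> complex" where
  "coef f \<equiv> fps_nth (fps_expansion f b)"

definition exponents :: "nat set" where
  "exponents = {k. \<exists>f\<in>Z. vanishes_exactly k f b}"

lemma zero_mem: "(\<lambda>_. 0) \<in> Z"
  using closed[OF one one, of "-1"] by simp

lemma sum_mem: "(\<And>i. i \<in> S \<Longrightarrow> g i \<in> Z) \<Longrightarrow> (\<lambda>t. \<Sum>i\<in>S. c i * g i t) \<in> Z"
proof (induction S rule: infinite_finite_induct)
  case (insert x F)
  then show ?case
    using closed[of "\<lambda>t. \<Sum>i\<in>F. c i * g i t" "g x" "c x"] by (simp add: add.commute)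
qed (simp_all add: zero_mem)

lemma coef_closed:
  assumes "f \<in> Z" "g \<in> Z"
  shows "coef (\<lambda>t. f t + c * g t) i = coef f i + c * coef g i"
  using assms
  by (simp add: fps_expansion_add fps_expansion_mult analytic analytic_intros)

lemma zero_exponent: "0 \<in> exponents"
  unfolding exponents_def vanishes_exactly_def
  by (intro CollectI bexI[OF _ one]) simp

text \<open>Elements of distinct orders have independent coefficient sequences, and these lie in the
  span of the finitely many sequences coming from \<open>finite_span\<close>.\<close>

lemma finite_exponents: "finite exponents"
proof -
  obtain B where B: "finite B" "B \<subseteq> Z" "\<And>f. f \<in> Z \<Longrightarrow> \<exists>c. f = (\<lambda>t. \<Sum>g\<in>B. c g * g t)"
    using finite_span by blast
  obtain f where f: "\<And>k. k \<in> exponents \<Longrightarrow> f k \<in> Z \<and> vanishes_exactly k (f k) b"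
    unfolding exponents_def using bchoice[of exponents "\<lambda>k f. f \<in> Z \<and> vanishes_exactly k f b"]
    by (auto simp: exponents_def)
  define v where "v k = coef (f k)" for k
  have ind: "cseq.independent (v ` exponents)" "inj_on v exponents"
    using f by (intro independent_echelon; simp add: v_def vanishes_exactly_def)+
  have "v k \<in> cseq.span (coef ` B)" if k: "k \<in> exponents" for k
  proof -
    obtain c where c: "f k = (\<lambda>t. \<Sum>g\<in>B. c g * g t)"
      using B(3) f[OF k] by blast
    have "v k = (\<Sum>g\<in>B. (\<lambda>i. c g * coef g i))"
      using B(2) by (auto simp: v_def c fun_eq_iff sum_fun_apply fps_nth_expansion_sum analytic subset_iff)
    also have "\<dots> \<in> cseq.span (coef ` B)"
      by (intro cseq.span_sum cseq.span_scale cseq.span_base) auto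
    finally show ?thesis .
  qed
  then have "finite (v ` exponents)"
    using cseq.independent_span_bound[of "coef ` B" "v ` exponents"] B(1) ind(1) by auto
  then show ?thesis using ind(2) by (rule finite_imageD)
qed

text \<open>The order of a nonzero germ from Z is itself an exponent, and the coefficient there is
  nonzero. Hence the coefficients at the exponents determine the germ of an element of Z.\<close>

lemma expansion_eq_0I:
  assumes "f \<in> Z" "\<And>e. e \<in> exponents \<Longrightarrow> coef f e = 0"
  shows "fps_expansion f b = 0"
proof (rule ccontr)
  assume nz: "fps_expansion f b \<noteq> 0"
  then have "vanishes_exactly (subdegree (fps_expansion f b)) f b"
    by (simp add: vanishes_exactly_iff_subdegree)
  then show False
    using assms nz by (force simp: exponents_def)
qed

text \<open>A triangular system, solved from the smallest index upwards: adding a multiple of an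
  element of order k corrects the coefficient at k and leaves the earlier ones alone.\<close>

lemma interpolation: "\<exists>f\<in>Z. \<forall>e\<in>exponents. coef f e = c e"
proof -
  have "\<exists>f\<in>Z. \<forall>e\<in>exponents. e < k \<longrightarrow> coef f e = c e" for k
  proof (induction k)
    case 0
    show ?case using one by blast
  next
    case (Suc k)
    then obtain f where f: "f \<in> Z" "\<forall>e\<in>exponents. e < k \<longrightarrow> coef f e = c e" by blast
    show ?case
    proof (cases "k \<in> exponents")
      case True
      then obtain g where g: "g \<in> Z" "coef g k \<noteq> 0" "\<And>j. j < k \<Longrightarrow> coef g j = 0"
        unfolding exponents_def vanishes_exactly_def by blast
      define s where "s = (c k - coef f k) / coef g k"
      have "\<forall>e\<in>exponents. e < Suc k \<longrightarrow> coef (\<lambda>t. f t + s * g t) e = c e"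
        using f g by (auto simp only: coef_closed less_Suc_eq) (auto simp: s_def)
      then show ?thesis using closed[OF f(1) g(1)] by blast
    next
      case False
      then show ?thesis using f by (metis less_antisym)
    qed
  qed
  from this[of "Suc (Max exponents)"] show ?thesis
    using finite_exponents by (simp add: less_Suc_eq_le)
qed

section \<open>The least space in terms of its exponents\<close>

lemma least_part_eq:
  "vanishes_exactly k f b \<Longrightarrow> least_part b f = monom (coef f k) k"
  by (auto simp: least_part_def Let_def vanishes_exactly_iff_subdegree)

text \<open>The polynomials supported on the exponents form a subspace containing all least parts.
  Conversely, each of their monomials is a multiple of the least part of an element of that
  order.\<close>

lemma mem_least_space_iff: "q \<in> least_space b Z \<longleftrightarrow> (\<forall>i. coeff q i \<noteq> 0 \<longrightarrow> i \<in> exponents)"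
proof
  define M where "M = {q :: complex poly. \<forall>i. coeff q i \<noteq> 0 \<longrightarrow> i \<in> exponents}"
  have "least_part b ` Z \<subseteq> M"
  proof (intro image_subsetI)
    fix f assume "f \<in> Z"
    show "least_part b f \<in> M"
    proof (cases "fps_expansion f b = 0")
      case True
      then show ?thesis by (simp add: least_part_def M_def)
    next
      case False
      then have "vanishes_exactly (subdegree (fps_expansion f b)) f b"
        by (simp add: vanishes_exactly_iff_subdegree)
      then show ?thesis
        using \<open>f \<in> Z\<close> by (auto simp: least_part_eq M_def exponents_def coeff_monom)
    qed
  qed
  moreover have "cpoly.subspace M"
    by (rule cpoly.subspaceI) (auto simp: M_def, metis add.right_neutral)
  ultimately have "least_space b Z \<subseteq> M"
    unfolding least_space_def by (rule cpoly.span_minimal)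
  then show "\<forall>i. coeff q i \<noteq> 0 \<longrightarrow> i \<in> exponents" if "q \<in> least_space b Z"
    using that by (auto simp: M_def)
next
  assume q: "\<forall>i. coeff q i \<noteq> 0 \<longrightarrow> i \<in> exponents"
  have "monom (coeff q i) i \<in> least_space b Z" for i
  proof (cases "coeff q i = 0")
    case True
    then show ?thesis by (simp add: least_space_def cpoly.span_zero)
  next
    case False
    then obtain f where f: "f \<in> Z" "vanishes_exactly i f b"
      using q by (auto simp: exponents_def)
    have "smult (coeff q i / coef f i) (least_part b f) \<in> least_space b Z"
      unfolding least_space_def using f(1) by (intro cpoly.span_scale cpoly.span_base) auto
    then show ?thesis
      using f(2) by (auto simp: least_part_eq smult_monom vanishes_exactly_def)
  qed
  then have "(\<Sum>i\<le>degree q. monom (coeff q i) i) \<in> least_space b Z"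
    unfolding least_space_def by (intro cpoly.span_sum) auto
  then show "q \<in> least_space b Z"
    by (simp add: poly_as_sum_of_monoms)
qed

lemma monom_mem_least_space_iff: "monom 1 k \<in> least_space b Z \<longleftrightarrow> k \<in> exponents"
  by (auto simp: mem_least_space_iff)

lemma gap_free_iff: "gap_free (least_space b Z) \<longleftrightarrow> exponents = {..<card exponents}"
proof
  assume "gap_free (least_space b Z)"
  then obtain N where N: "exponents = {0..N}"
    unfolding gap_free_def monom_mem_least_space_iff by auto
  have "card exponents = Suc N" unfolding N by simp
  then show "exponents = {..<card exponents}"
    using N by (simp only: atLeast0AtMost lessThan_Suc_atMost)
next
  assume E: "exponents = {..<card exponents}"
  have "card exponents \<noteq> 0"
    using zero_exponent finite_exponents by auto
  then obtain N where N: "card exponents = Suc N"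
    using not0_implies_Suc by blast
  have "exponents = {0..N}"
    using E unfolding N lessThan_Suc_atMost atLeast0AtMost .
  then show "gap_free (least_space b Z)"
    unfolding gap_free_def monom_mem_least_space_iff Collect_mem_eq by (rule exI)
qed

text \<open>A finite nonempty set closed under predecessors is an initial segment. Comparing
  neighbours suits both a derivative, which lowers degrees by one, and a quadratic change of
  parameter, whose first effect is on the next coefficient.\<close>

lemma gap_freeI:
  assumes down: "\<And>i. Suc i \<in> exponents \<Longrightarrow> i \<in> exponents"
  shows "gap_free (least_space b Z)"
proof -
  have "i \<in> exponents" if "k \<in> exponents" "i \<le> k" for i k
    using that(2,1) by (induction i rule: inc_induct) (auto intro: down)
  moreover have "Max exponents \<in> exponents"
    using finite_exponents zero_exponent by (intro Max_in) auto
  ultimately have "exponents = {0..Max exponents}"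
    using Max_ge[OF finite_exponents] unfolding set_eq_iff atLeastAtMost_iff by blast
  then show ?thesis
    unfolding gap_free_def monom_mem_least_space_iff Collect_mem_eq by (rule exI)
qed

text \<open>In characteristic 0 the derivative of the monomial of degree i + 1 is a nonzero multiple
  of that of degree i, so closure under it amounts to closure of the exponents under
  predecessors.\<close>

lemma gap_free_iff_closed_under_derivative:
  "gap_free (least_space b Z) \<longleftrightarrow> closed_under_derivative (least_space b Z)"
proof
  assume "gap_free (least_space b Z)"
  then have "exponents = {..<card exponents}" by (simp add: gap_free_iff)
  then have down: "i \<in> exponents" if "Suc i \<in> exponents" for i
    using that by (metis Suc_lessD lessThan_iff)
  then show "closed_under_derivative (least_space b Z)"
    unfolding closed_under_derivative_def by (auto simp: coeff_pderiv mem_least_space_iff)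
next
  assume cl: "closed_under_derivative (least_space b Z)"
  show "gap_free (least_space b Z)"
  proof (rule gap_freeI)
    fix i assume "Suc i \<in> exponents"
    then have "pderiv (monom 1 (Suc i)) \<in> least_space b Z"
      using cl unfolding closed_under_derivative_def by (simp add: monom_mem_least_space_iff)
    moreover have "coeff (pderiv (monom (1::complex) (Suc i))) i \<noteq> 0"
      using of_nat_neq_0[of i, where ?'a = complex] by (simp add: coeff_pderiv del: of_nat_Suc)
    ultimately show "i \<in> exponents"
      unfolding mem_least_space_iff by blast
  qed
qed

text \<open>Pairing with the monomial of degree e isolates the conjugate of the e-th coefficient up
  to the factor e!. In the pairing with a general q only indices in \<open>exponents\<close>
  contribute.\<close>

lemma taylor_pairing_zero_iff:
  "(\<forall>q\<in>least_space b Z. taylor_pairing b q g = 0) \<longleftrightarrow> (\<forall>e\<in>exponents. coef g e = 0)"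
proof (intro iffI ballI)
  fix e assume pair: "\<forall>q\<in>least_space b Z. taylor_pairing b q g = 0" and "e \<in> exponents"
  then have "taylor_pairing b (monom 1 e) g = 0"
    by (simp add: monom_mem_least_space_iff)
  moreover have "taylor_pairing b (monom 1 e) g = (\<Sum>i\<le>e. if i = e then fact e * cnj (coef g e) else 0)"
    unfolding taylor_pairing_def degree_monom_eq[OF one_neq_zero] by (intro sum.cong) auto
  ultimately show "coef g e = 0" by simp
next
  fix q assume "\<forall>e\<in>exponents. coef g e = 0" "q \<in> least_space b Z"
  then show "taylor_pairing b q g = 0"
    unfolding taylor_pairing_def mem_least_space_iff by (intro sum.neutral) auto
qed

end

section \<open>Dimensions of jet spaces\<close>

lemma jet_eq_expansion:
  "jet k f t = (\<lambda>i. if i \<le> k then fps_nth (fps_expansion f t) i else 0)"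
  by (simp add: fun_eq_iff jet_def fps_expansion_def)

lemma jet_space_subset_span_units:
  "jet_space Z b W k t \<subseteq> cseq.span ((\<lambda>j i. if i = j then 1 else 0) ` {..k})"
proof
  fix v assume "v \<in> jet_space Z b W k t"
  then have "v i = 0" if "i > k" for i
    using that by (auto simp: jet_space_def jet_def)
  then have "v = (\<Sum>j\<le>k. (\<lambda>i. v j * (if i = j then 1 else 0)))"
    by (auto simp: fun_eq_iff sum_fun_apply if_distrib cong: if_cong)
  also have "\<dots> \<in> cseq.span ((\<lambda>j i. if i = j then 1 else 0) ` {..k})"
    by (intro cseq.span_sum cseq.span_scale cseq.span_base) auto
  finally show "v \<in> cseq.span ((\<lambda>j i. if i = j then 1 else 0) ` {..k})" .
qed

lemma dim_jet_space_le: "cseq.dim (jet_space Z b W k t) \<le> Suc k"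
proof -
  have "cseq.dim (jet_space Z b W k t) \<le> card ((\<lambda>j i. if i = j then 1 else (0 :: complex)) ` {..k})"
    by (rule cseq.dim_le_card[OF jet_space_subset_span_units]) simp
  also have "\<dots> \<le> Suc k"
    using card_image_le[of "{..k}" "\<lambda>j i. if i = j then 1 else (0 :: complex)"] by simp
  finally show ?thesis .
qed

text \<open>Truncation at k does not affect the first nonzero entry of a function of order at most
  k, so the jets are in echelon form.\<close>

lemma card_le_dim_jet_space:
  assumes S: "S \<subseteq> {..k}"
    and ex: "\<And>s. s \<in> S \<Longrightarrow> \<exists>r\<in>representatives Z b W. vanishes_exactly s r t"
  shows "card S \<le> cseq.dim (jet_space Z b W k t)"
proof -
  obtain r where r: "\<And>s. s \<in> S \<Longrightarrow> r s \<in> representatives Z b W \<and> vanishes_exactly s (r s) t"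
    using ex bchoice[of S "\<lambda>s r. r \<in> representatives Z b W \<and> vanishes_exactly s r t"] by auto
  define v where "v s = jet k (r s) t" for s
  have ind: "cseq.independent (v ` S)" "inj_on v S"
    using r S by (intro independent_echelon; force simp: v_def jet_eq_expansion vanishes_exactly_def)+
  obtain B where B: "B \<subseteq> jet_space Z b W k t" "cseq.independent B"
    "jet_space Z b W k t \<subseteq> cseq.span B" "card B = cseq.dim (jet_space Z b W k t)"
    by (rule cseq.basis_exists)
  \<comment> \<open>The comparison with \<open>B\<close> requires a finite spanning set; the unit
    vectors bound its size.\<close>
  have "finite B"
    using cseq.independent_span_bound[OF _ B(2), of "(\<lambda>j i. if i = j then 1 else 0) ` {..k}"]
      B(1) jet_space_subset_span_units[of Z b W k t] by auto
  moreover have "v ` S \<subseteq> cseq.span B"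
    using r B(3) by (auto simp: v_def jet_space_def)
  ultimately have "card (v ` S) \<le> card B"
    using cseq.independent_span_bound[OF _ ind(1)] by blast
  then show ?thesis
    using B(4) card_image[OF ind(2)] by simp
qed

section \<open>Bundle points\<close>

context germ_space
begin

text \<open>A family dual to the coefficients at the exponents. The order of \<open>G e\<close> is
  an exponent at which \<open>G e\<close> has a nonzero coefficient, and e is the only such
  exponent.\<close>

lemma echelon_basis:
  obtains G where "\<And>e. e \<in> exponents \<Longrightarrow> G e \<in> Z"
    "\<And>e e'. e \<in> exponents \<Longrightarrow> e' \<in> exponents \<Longrightarrow> coef (G e) e' = (if e' = e then 1 else 0)"
    "\<And>e. e \<in> exponents \<Longrightarrow> vanishes_exactly e (G e) b"
proof -
  have "\<exists>f. f \<in> Z \<and> (\<forall>e'\<in>exponents. coef f e' = (if e' = e then 1 else 0))" for e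
    using interpolation[of "\<lambda>e'. if e' = e then 1 else 0"] by blast
  then obtain G where G: "\<And>e. G e \<in> Z"
    "\<And>e e'. e' \<in> exponents \<Longrightarrow> coef (G e) e' = (if e' = e then 1 else 0)"
    by metis
  have "vanishes_exactly e (G e) b" if e: "e \<in> exponents" for e
  proof -
    have nz: "fps_expansion (G e) b \<noteq> 0"
      using G(2)[of e e] e by auto
    then have "vanishes_exactly (subdegree (fps_expansion (G e) b)) (G e) b"
      by (simp add: vanishes_exactly_iff_subdegree)
    then have "subdegree (fps_expansion (G e) b) \<in> exponents"
      using G(1) by (auto simp: exponents_def)
    then have "subdegree (fps_expansion (G e) b) = e"
      using G(2) nz by (metis nth_subdegree_nonzero)
    then show ?thesis
      using nz by (simp add: vanishes_exactly_iff_subdegree)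
  qed
  then show thesis using that G by blast
qed

text \<open>Stated without membership in Z, because it is applied to the representatives on
  W.\<close>

lemma coef_echelon_sum:
  assumes "\<And>e. e \<in> exponents \<Longrightarrow> G e analytic_on {b}"
    "\<And>e e'. e \<in> exponents \<Longrightarrow> e' \<in> exponents \<Longrightarrow> coef (G e) e' = (if e' = e then 1 else 0)"
    "k \<in> exponents"
  shows "coef (\<lambda>x. \<Sum>e\<in>exponents. c e * G e x) k = c k"
proof -
  have "coef (\<lambda>x. \<Sum>e\<in>exponents. c e * G e x) k = (\<Sum>e\<in>exponents. c e * coef (G e) k)"
    using assms(1) by (rule fps_nth_expansion_sum)
  also have "\<dots> = (\<Sum>e\<in>exponents. if e = k then c k else 0)"
    using assms(2,3) by (intro sum.cong) auto
  finally show ?thesis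
    using finite_exponents assms(3) by simp
qed

lemma bundle_point_iff_gap_free:
  assumes "representing_neighbourhood Z b W"
  shows "bundle_point Z b W \<longleftrightarrow> gap_free (least_space b Z)"
proof -
  have W: "open W" "connected W" "b \<in> W" "W \<noteq> {}"
    and rep: "\<And>f. f \<in> Z \<Longrightarrow> \<exists>g. g holomorphic_on W \<and> (\<forall>\<^sub>F t in nhds b. g t = f t)"
    using assms by (auto simp: representing_neighbourhood_def)
  let ?R = "representatives Z b W"
  let ?E = exponents
  have ana: "g analytic_on {t}" if "g holomorphic_on W" "t \<in> W" for g t
    using that W by (auto simp: analytic_at)
  obtain G0 where G0: "\<And>e. e \<in> ?E \<Longrightarrow> G0 e \<in> Z"
    "\<And>e e'. e \<in> ?E \<Longrightarrow> e' \<in> ?E \<Longrightarrow> coef (G0 e) e' = (if e' = e then 1 else 0)"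
    "\<And>e. e \<in> ?E \<Longrightarrow> vanishes_exactly e (G0 e) b"
    by (rule echelon_basis) blast
  obtain G where G: "\<And>e. e \<in> ?E \<Longrightarrow> G e holomorphic_on W \<and> (\<forall>\<^sub>F t in nhds b. G e t = G0 e t)"
    using bchoice[of ?E "\<lambda>e g. g holomorphic_on W \<and> (\<forall>\<^sub>F t in nhds b. g t = G0 e t)"] rep G0(1) by auto
  have holG: "G e holomorphic_on W" if "e \<in> ?E" for e using G that by blast
  have expG: "fps_expansion (G e) b = fps_expansion (G0 e) b" if "e \<in> ?E" for e
    using G that by (intro fps_expansion_cong) auto
  have coefG: "coef (G e) e' = (if e' = e then 1 else 0)" if "e \<in> ?E" "e' \<in> ?E" for e e'
    using G0(2) expG that by simp
  have near_sum: "\<forall>\<^sub>F t in nhds b. (\<Sum>e\<in>?E. c e * G e t) = (\<Sum>e\<in>?E. c e * G0 e t)" for c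
  proof -
    have "\<forall>\<^sub>F t in nhds b. \<forall>e\<in>?E. G e t = G0 e t"
      using G finite_exponents by (simp add: eventually_ball_finite_distrib)
    then show ?thesis by eventually_elim simp
  qed
  have sum_rep: "(\<lambda>t. \<Sum>e\<in>?E. c e * G e t) \<in> ?R" for c
    unfolding representatives_def using near_sum[of c] sum_mem[of ?E G0 c] G0(1) holG
    by (auto intro!: holomorphic_intros bexI[of _ "\<lambda>t. \<Sum>e\<in>?E. c e * G0 e t"])
  have coef_sum: "coef (\<lambda>t. \<Sum>e\<in>?E. c e * G e t) k = c k" if "k \<in> ?E" for c k
    using coefG that ana[OF holG W(3)] by (intro coef_echelon_sum) auto
  \<comment> \<open>The coefficients at the exponents determine the germ at b, so r agrees near b
    with the combination having the same ones. Connectedness of W spreads the identity to all of W,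
    which bounds the jet spaces at every point by \<open>card exponents\<close>.\<close>
  have expand: "\<exists>c. \<forall>x\<in>W. r x = (\<Sum>e\<in>?E. c e * G e x)" if r: "r \<in> ?R" for r
  proof -
    obtain f where f: "r holomorphic_on W" "f \<in> Z" "\<forall>\<^sub>F t in nhds b. r t = f t"
      using r by (auto simp: representatives_def)
    define c where "c = coef r"
    define d where "d t = f t + (-1) * (\<Sum>e\<in>?E. c e * G0 e t)" for t
    have sumZ: "(\<lambda>t. \<Sum>e\<in>?E. c e * G0 e t) \<in> Z"
      using G0(1) by (rule sum_mem)
    have "d \<in> Z"
      unfolding d_def using f(2) sumZ by (rule closed)
    have "coef d k = 0" if "k \<in> ?E" for k
      using fps_expansion_cong[OF f(3)] fps_expansion_cong[OF near_sum[of c]] coef_sum[OF that, of c]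
      unfolding d_def coef_closed[OF f(2) sumZ] by (simp add: c_def)
    with \<open>d \<in> Z\<close> have "fps_expansion d b = 0" by (rule expansion_eq_0I)
    then have "\<forall>\<^sub>F t in nhds b. d t = 0"
      using fps_expansion_eq_0_iff[OF analytic[OF \<open>d \<in> Z\<close>]] by simp
    then have zero: "\<forall>\<^sub>F t in nhds b. r t - (\<Sum>e\<in>?E. c e * G e t) = 0"
      using f(3) near_sum[of c] by eventually_elim (simp add: d_def)
    have "r x - (\<Sum>e\<in>?E. c e * G e x) = 0" if "x \<in> W" for x
    proof (rule holomorphic_zero_germ[OF _ W(1-3) zero that])
      show "(\<lambda>x. r x - (\<Sum>e\<in>?E. c e * G e x)) holomorphic_on W"
        using f(1) holG by (intro holomorphic_intros) auto
    qed
    then show ?thesis by auto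
  qed
  have indep: "\<forall>e\<in>?E. c e = 0" if c: "\<forall>x\<in>W. (\<Sum>e\<in>?E. c e * G e x) = 0" for c
  proof -
    have "\<forall>\<^sub>F t in nhds b. (\<Sum>e\<in>?E. c e * G e t) = 0"
      using eventually_nhds_in_open[OF W(1,3)] by eventually_elim (use c in blast)
    then have "fps_expansion (\<lambda>t. \<Sum>e\<in>?E. c e * G e t) b = fps_expansion (\<lambda>_. 0) b"
      by (rule fps_expansion_cong)
    then show ?thesis using coef_sum[of _ c] by simp
  qed
  have jet_expand: "\<exists>c. jet k r t = (\<Sum>e\<in>?E. (\<lambda>i. c e * jet k (G e) t i))"
    if r: "r \<in> ?R" and t: "t \<in> W" for r k t
  proof -
    obtain c where c: "\<forall>x\<in>W. r x = (\<Sum>e\<in>?E. c e * G e x)"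
      using expand[OF r] by blast
    have ev: "\<forall>\<^sub>F x in nhds t. r x = (\<Sum>e\<in>?E. c e * G e x)"
      using eventually_nhds_in_open[OF W(1) t] by eventually_elim (use c in blast)
    have "fps_nth (fps_expansion r t) i = (\<Sum>e\<in>?E. c e * fps_nth (fps_expansion (G e) t) i)" for i
      unfolding fps_expansion_cong[OF ev] using ana[OF holG t] by (intro fps_nth_expansion_sum)
    then show ?thesis
      by (intro exI[of _ c]) (auto simp: jet_eq_expansion fun_eq_iff sum_fun_apply)
  qed
  have dim_le_card: "cseq.dim (jet_space Z b W k t) \<le> card ?E" if t: "t \<in> W" for k t
  proof -
    have "jet_space Z b W k t \<subseteq> cseq.span ((\<lambda>e. jet k (G e) t) ` ?E)"
    proof
      fix v assume "v \<in> jet_space Z b W k t"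
      then obtain c where "v = (\<Sum>e\<in>?E. (\<lambda>i. c e * jet k (G e) t i))"
        using jet_expand[OF _ t] by (auto simp: jet_space_def)
      then show "v \<in> cseq.span ((\<lambda>e. jet k (G e) t) ` ?E)"
        by (auto intro!: cseq.span_sum cseq.span_scale intro: cseq.span_base)
    qed
    then have "cseq.dim (jet_space Z b W k t) \<le> card ((\<lambda>e. jet k (G e) t) ` ?E)"
      using finite_exponents by (intro cseq.dim_le_card) auto
    then show ?thesis
      using card_image_le[OF finite_exponents] order_trans by blast
  qed
  have dim_b_le: "cseq.dim (jet_space Z b W k b) \<le> card (?E \<inter> {..k})" for k
  proof -
    have "jet_space Z b W k b \<subseteq> cseq.span ((\<lambda>e. jet k (G e) b) ` (?E \<inter> {..k}))"
    proof
      fix v assume "v \<in> jet_space Z b W k b"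
      then obtain c where v: "v = (\<Sum>e\<in>?E. (\<lambda>i. c e * jet k (G e) b i))"
        using jet_expand[OF _ W(3)] by (auto simp: jet_space_def)
      \<comment> \<open>At b, basis elements of order greater than k have zero k-jet.\<close>
      have "(\<Sum>e\<in>?E. (\<lambda>i. c e * jet k (G e) b i)) = (\<Sum>e\<in>?E \<inter> {..k}. (\<lambda>i. c e * jet k (G e) b i))"
      proof (rule sum.mono_neutral_right)
        show "\<forall>e\<in>?E - ?E \<inter> {..k}. (\<lambda>i. c e * jet k (G e) b i) = 0"
          using G0(3) expG
          by (auto simp: jet_eq_expansion vanishes_exactly_def fun_eq_iff) (meson le_less_trans not_le)
      qed (use finite_exponents in auto)
      then show "v \<in> cseq.span ((\<lambda>e. jet k (G e) b) ` (?E \<inter> {..k}))"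
        unfolding v by (auto intro!: cseq.span_sum cseq.span_scale intro: cseq.span_base)
    qed
    then have "cseq.dim (jet_space Z b W k b) \<le> card ((\<lambda>e. jet k (G e) b) ` (?E \<inter> {..k}))"
      using finite_exponents by (intro cseq.dim_le_card) auto
    then show ?thesis
      using card_image_le[of "?E \<inter> {..k}"] finite_exponents order_trans by blast
  qed
  \<comment> \<open>\<open>Max\<close> is taken over the infinite set W, but the dimensions stay
    below k + 2.\<close>
  have finite_dims: "finite ((\<lambda>t. cseq.dim (jet_space Z b W k t)) ` W)" for k
    by (rule finite_subset[of _ "{..Suc k}"]) (auto intro: dim_jet_space_le)
  show ?thesis
  proof
    assume bp: "bundle_point Z b W"
    obtain t where t: "t \<in> W"
      "\<forall>k<card ?E. \<exists>c. vanishes_exactly k (\<lambda>x. \<Sum>e\<in>?E. c e * G e x) t"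
      using exists_point_all_orders[OF finite_exponents W(1,2,4), of G] holG indep by blast
    \<comment> \<open>One jet order suffices. With n = \<open>card exponents\<close> and k = n - 1,
      the dimension n is reached at t, hence at b; so all n exponents lie among the n indices 0,
      ..., k and fill them.\<close>
    define k where "k = card ?E - 1"
    have k: "{..<card ?E} = {..k}"
      using zero_exponent finite_exponents
      by (metis Suc_pred' card_gt_0_iff empty_iff k_def lessThan_Suc_atMost)
    have "card {..<card ?E} \<le> cseq.dim (jet_space Z b W k t)"
    proof (rule card_le_dim_jet_space)
      show "\<exists>r\<in>?R. vanishes_exactly s r t" if "s \<in> {..<card ?E}" for s
        using t(2) that sum_rep by blast
    qed (use k in simp)
    also have "\<dots> \<le> Max ((\<lambda>t. cseq.dim (jet_space Z b W k t)) ` W)"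
      using finite_dims t(1) by (intro Max_ge) auto
    also have "\<dots> = cseq.dim (jet_space Z b W k b)"
      using bp by (simp add: bundle_point_def)
    also have "\<dots> \<le> card (?E \<inter> {..k})"
      by (rule dim_b_le)
    finally have card: "card ?E \<le> card (?E \<inter> {..k})" by simp
    then have "?E \<inter> {..k} = ?E"
      using finite_exponents by (intro card_seteq) auto
    moreover have "?E \<inter> {..k} = {..k}"
      using card arg_cong[OF k, of card] by (intro card_seteq) auto
    ultimately have "?E = {..k}"
      by (rule trans[OF sym])
    also have "\<dots> = {..<card ?E}"
      using k by (rule sym)
    finally show "gap_free (least_space b Z)"
      unfolding gap_free_iff .
  next
    assume "gap_free (least_space b Z)"
    then have E: "?E = {..<card ?E}" unfolding gap_free_iff .
    show "bundle_point Z b W"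
      unfolding bundle_point_def
    proof
      fix k
      have "cseq.dim (jet_space Z b W k t) \<le> cseq.dim (jet_space Z b W k b)" if "t \<in> W" for t
      proof -
        have "cseq.dim (jet_space Z b W k t) \<le> min (Suc k) (card ?E)"
          using dim_jet_space_le dim_le_card[OF that] by simp
        also have "\<dots> = card ({..<card ?E} \<inter> {..k})"
          by (simp add: greaterThan_Int_greaterThan min.commute flip: lessThan_Suc_atMost)
        also have "\<dots> = card (?E \<inter> {..k})"
          using arg_cong[OF E, of "\<lambda>S. card (S \<inter> {..k})"] by (rule sym)
        also have "\<dots> \<le> cseq.dim (jet_space Z b W k b)"
        proof (rule card_le_dim_jet_space)
          fix s assume s: "s \<in> ?E \<inter> {..k}"
          obtain g where "g holomorphic_on W" "\<forall>\<^sub>F t in nhds b. g t = G0 s t"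
            using rep[OF G0(1)] s by blast
          then show "\<exists>r\<in>?R. vanishes_exactly s r b"
            using G0(1,3)[of s] s vanishes_exactly_cong unfolding representatives_def by blast
        qed simp
        finally show ?thesis .
      qed
      then show "cseq.dim (jet_space Z b W k b) = Max ((\<lambda>t. cseq.dim (jet_space Z b W k t)) ` W)"
        using finite_dims W(3) by (intro Max_eqI[symmetric]) auto
    qed
  qed
qed

end

section \<open>Local parametrisations\<close>

lemma has_derivative_curve:
  fixes \<Phi> :: "complex \<Rightarrow> (complex, 'm::finite) vec"
  assumes "\<And>i. ((\<lambda>t. \<Phi> t $ i) has_field_derivative D $ i) (at t)"
  shows "(\<Phi> has_derivative (\<lambda>h. h *s D)) (at t)"
proof (subst has_derivative_componentwise_within, rule ballI)
  fix e :: "(complex, 'm) vec" assume "e \<in> Basis"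
  then obtain j u where e: "e = axis j u" by (auto simp: Basis_vec_def)
  have "((\<lambda>t. \<Phi> t $ j) has_derivative (\<lambda>h. h * D $ j)) (at t)"
    using assms[of j] by (simp add: has_field_derivative_def mult.commute[of _ "D $ j"])
  then show "((\<lambda>t. \<Phi> t \<bullet> e) has_derivative (\<lambda>h. (h *s D) \<bullet> e)) (at t)"
    unfolding e inner_axis vector_smult_component by (rule has_derivative_inner_left)
qed

lemma continuous_on_curve:
  fixes \<Phi> :: "complex \<Rightarrow> (complex, 'm::finite) vec"
  assumes "\<And>i. (\<lambda>t. \<Phi> t $ i) holomorphic_on W"
  shows "continuous_on W \<Phi>"
  using continuous_on_vec_lambda[of W "\<lambda>i t. \<Phi> t $ i"] holomorphic_on_imp_continuous_on[OF assms]
  by simp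

text \<open>The real chain rule gives the derivative \<open>L (h *s D)\<close>; homogeneity of L
  over the complex numbers turns it into h times \<open>L D\<close>, which is complex
  differentiability.\<close>

lemma analytic_compose_curve:
  fixes \<Phi> :: "complex \<Rightarrow> (complex, 'm::finite) vec"
  assumes \<Phi>: "\<And>i. (\<lambda>t. \<Phi> t $ i) holomorphic_on W" "open W" "b \<in> W"
    and G: "holomorphic_several_on G N" "open N" "\<Phi> b \<in> N"
  shows "(\<lambda>t. G (\<Phi> t)) analytic_on {b}"
proof -
  define S where "S = W \<inter> \<Phi> -` N"
  have "open S"
    unfolding S_def using continuous_on_curve[OF \<Phi>(1)] \<Phi>(2) G(2) by (intro continuous_open_preimage)
  moreover have "(\<lambda>t. G (\<Phi> t)) field_differentiable (at t)" if "t \<in> S" for t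
  proof -
    have t: "t \<in> W" "\<Phi> t \<in> N" using that by (auto simp: S_def)
    define D where "D = (\<chi> i. deriv (\<lambda>t. \<Phi> t $ i) t)"
    have \<Phi>': "(\<Phi> has_derivative (\<lambda>h. h *s D)) (at t)"
      using holomorphic_derivI[OF \<Phi>(1,2) t(1)] by (intro has_derivative_curve) (simp add: D_def)
    obtain L where L: "(G has_derivative L) (at (\<Phi> t))" "\<And>c v. L (c *s v) = c * L v"
      using G(1) t(2) unfolding holomorphic_several_on_def by blast
    have "((\<lambda>t. G (\<Phi> t)) has_derivative (\<lambda>h. L (h *s D))) (at t)"
      using \<Phi>' L(1) by (rule has_derivative_compose)
    then have "((\<lambda>t. G (\<Phi> t)) has_field_derivative L D) (at t)"
      by (simp add: has_field_derivative_def L(2) mult.commute[of _ "L D"])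
    then show ?thesis
      by (auto simp: field_differentiable_def)
  qed
  ultimately have "(\<lambda>t. G (\<Phi> t)) holomorphic_on S"
    using field_differentiable_at_within by (auto simp: holomorphic_on_def)
  then show ?thesis
    using \<open>open S\<close> \<Phi>(3) G(3) by (auto simp: analytic_at S_def)
qed

lemma holomorphic_on_subset_compose:
  fixes \<theta> :: "(complex, 'm::finite) vec \<Rightarrow> complex"
  assumes \<theta>: "holomorphic_on_subset \<theta> Y" and k: "k holomorphic_on B" "open B" "\<theta> ` Y \<subseteq> B"
  shows "holomorphic_on_subset (\<lambda>x. k (\<theta> x)) Y"
  unfolding holomorphic_on_subset_def
proof
  fix p assume p: "p \<in> Y"
  obtain N G where N: "open N" "p \<in> N" "holomorphic_several_on G N" "\<forall>x\<in>Y \<inter> N. \<theta> x = G x"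
    using \<theta> p unfolding holomorphic_on_subset_def by blast
  have "continuous_on N G"
    using N(3) unfolding holomorphic_several_on_def
    by (meson continuous_at_imp_continuous_on has_derivative_continuous)
  \<comment> \<open>The extension G agrees with \<theta> only on Y and may leave B elsewhere, so N
    has to be shrunk.\<close>
  then have "open (N \<inter> G -` B)"
    using N(1) k(2) by (rule continuous_open_preimage)
  moreover have "p \<in> N \<inter> G -` B"
    using N p k(3) by auto
  moreover have "holomorphic_several_on (\<lambda>x. k (G x)) (N \<inter> G -` B)"
    unfolding holomorphic_several_on_def
  proof
    fix x assume x: "x \<in> N \<inter> G -` B"
    obtain L where L: "(G has_derivative L) (at x)" "\<And>c v. L (c *s v) = c * L v"
      using N(3) x unfolding holomorphic_several_on_def by blast
    have "(k has_derivative (*) (deriv k (G x))) (at (G x))"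
      using holomorphic_derivI[OF k(1,2), of "G x"] x by (simp add: has_field_derivative_def)
    then have "((\<lambda>x. k (G x)) has_derivative (\<lambda>v. deriv k (G x) * L v)) (at x)"
      by (rule has_derivative_compose[OF L(1)])
    then show "\<exists>L. ((\<lambda>x. k (G x)) has_derivative L) (at x) \<and> (\<forall>c v. L (c *s v) = c * L v)"
      using L(2) by (intro exI[of _ "\<lambda>v. deriv k (G x) * L v"]) auto
  qed
  ultimately show "\<exists>N G. open N \<and> p \<in> N \<and> holomorphic_several_on G N \<and> (\<forall>x\<in>Y \<inter> N. k (\<theta> x) = G x)"
    using N(4) by (intro exI[of _ "N \<inter> G -` B"] exI[of _ "\<lambda>x. k (G x)"]) auto
qed

lemma holomorphic_on_subset_mono:
  assumes "holomorphic_on_subset f Y" "Y' \<subseteq> Y"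
  shows "holomorphic_on_subset f Y'"
  unfolding holomorphic_on_subset_def
proof
  fix p assume "p \<in> Y'"
  then obtain N G where "open N" "p \<in> N" "holomorphic_several_on G N" "\<forall>x\<in>Y \<inter> N. f x = G x"
    using assms unfolding holomorphic_on_subset_def by blast
  then show "\<exists>N G. open N \<and> p \<in> N \<and> holomorphic_several_on G N \<and> (\<forall>x\<in>Y' \<inter> N. f x = G x)"
    using assms(2) by (intro exI[of _ N] exI[of _ G]) auto
qed

text \<open>The dictionary between germs on X at a and germs in the parameter at b. From left to
  right \<Phi> must be open onto a relative neighbourhood of a in X; the converse uses its
  continuity.\<close>

lemma local_parametrisation_eventually_iff:
  assumes "local_parametrisation X a b \<Phi>"
  shows "(\<forall>\<^sub>F t in nhds b. P (\<Phi> t)) \<longleftrightarrow> (\<exists>V. open V \<and> a \<in> V \<and> (\<forall>x\<in>X \<inter> V. P x))"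
proof -
  obtain W V \<theta> where \<Phi>: "\<Phi> b = a" "open W" "b \<in> W" "open V" "a \<in> V"
    "\<And>i. (\<lambda>t. \<Phi> t $ i) holomorphic_on W" "homeomorphism W (X \<inter> V) \<Phi> \<theta>"
    using assms unfolding local_parametrisation_def by blast
  show ?thesis
  proof
    assume "\<forall>\<^sub>F t in nhds b. P (\<Phi> t)"
    then obtain S where S: "open S" "b \<in> S" "\<And>t. t \<in> S \<Longrightarrow> P (\<Phi> t)"
      unfolding eventually_nhds by blast
    have "openin (top_of_set (X \<inter> V)) (\<Phi> ` (W \<inter> S))"
      using \<Phi>(7) by (rule homeomorphism_imp_open_map) (use S(1) in auto)
    then obtain T where T: "open T" "\<Phi> ` (W \<inter> S) = X \<inter> V \<inter> T"
      unfolding openin_open by blast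
    have "a \<in> V \<inter> T"
      using T(2) \<Phi>(1,3) S(2) by (metis Int_iff imageI)
    moreover have "P x" if "x \<in> X \<inter> (V \<inter> T)" for x
    proof -
      have "x \<in> \<Phi> ` (W \<inter> S)" using T(2) that by auto
      then show ?thesis using S(3) by auto
    qed
    ultimately show "\<exists>V. open V \<and> a \<in> V \<and> (\<forall>x\<in>X \<inter> V. P x)"
      using T(1) \<Phi>(4) by (intro exI[of _ "V \<inter> T"]) auto
  next
    assume "\<exists>V. open V \<and> a \<in> V \<and> (\<forall>x\<in>X \<inter> V. P x)"
    then obtain V' where V': "open V'" "a \<in> V'" "\<forall>x\<in>X \<inter> V'. P x" by blast
    have "open (W \<inter> \<Phi> -` V')"
      using continuous_on_curve[OF \<Phi>(6)] \<Phi>(2) V'(1) by (intro continuous_open_preimage)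
    then have "\<forall>\<^sub>F t in nhds b. t \<in> W \<inter> \<Phi> -` V'"
      using \<Phi>(1,3) V'(2) by (intro eventually_nhds_in_open) auto
    then show "\<forall>\<^sub>F t in nhds b. P (\<Phi> t)"
    proof eventually_elim
      case (elim t)
      then have "\<Phi> t \<in> X \<inter> V'"
        using homeomorphism_image1[OF \<Phi>(7)] by auto
      then show ?case using V'(3) by blast
    qed
  qed
qed

lemma analytic_pullback:
  assumes lp: "local_parametrisation X a b \<Phi>"
    and f: "holomorphic_on_subset f (X \<inter> V)" "open V" "a \<in> V" and "a \<in> X"
  shows "(\<lambda>t. f (\<Phi> t)) analytic_on {b}"
proof -
  obtain W where \<Phi>: "\<Phi> b = a" "open W" "b \<in> W" "\<And>i. (\<lambda>t. \<Phi> t $ i) holomorphic_on W"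
    using lp unfolding local_parametrisation_def by blast
  obtain N G where N: "open N" "a \<in> N" "holomorphic_several_on G N" "\<forall>x\<in>X \<inter> V \<inter> N. f x = G x"
    using f \<open>a \<in> X\<close> unfolding holomorphic_on_subset_def by blast
  have "(\<lambda>t. G (\<Phi> t)) analytic_on {b}"
    using \<Phi> N by (intro analytic_compose_curve[of \<Phi> W b G N]) auto
  moreover have "\<forall>\<^sub>F t in nhds b. f (\<Phi> t) = G (\<Phi> t)"
    unfolding local_parametrisation_eventually_iff[OF lp, of "\<lambda>x. f x = G x"]
    using N f(2,3) by (intro exI[of _ "V \<inter> N"]) auto
  ultimately show ?thesis
    using analytic_at_cong[of "\<lambda>t. f (\<Phi> t)" "\<lambda>t. G (\<Phi> t)" b b] by simp
qed

text \<open>The witness is the inverse of \<open>\<Phi>1\<close> composed with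
  \<open>\<Phi>2\<close>, analytic as the pull-back of a holomorphic function on X.\<close>

lemma transition_map:
  assumes lp1: "local_parametrisation X a b1 \<Phi>1" and lp2: "local_parametrisation X a b2 \<Phi>2"
    and "a \<in> X"
  obtains h where "h analytic_on {b2}" "h b2 = b1" "\<forall>\<^sub>F t in nhds b2. \<Phi>2 t = \<Phi>1 (h t)"
proof -
  obtain W V \<theta> where \<Phi>1: "\<Phi>1 b1 = a" "b1 \<in> W" "open V" "a \<in> V"
    "homeomorphism W (X \<inter> V) \<Phi>1 \<theta>" "holomorphic_on_subset \<theta> (X \<inter> V)"
    using lp1 unfolding local_parametrisation_def by blast
  have "(\<lambda>t. \<theta> (\<Phi>2 t)) analytic_on {b2}"
    by (rule analytic_pullback[OF lp2 \<Phi>1(6,3,4) \<open>a \<in> X\<close>])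
  moreover have "\<theta> (\<Phi>2 b2) = b1"
    using lp2 \<Phi>1(1,2) homeomorphism_apply1[OF \<Phi>1(5)] by (auto simp: local_parametrisation_def)
  moreover have "\<forall>\<^sub>F t in nhds b2. \<Phi>2 t = \<Phi>1 (\<theta> (\<Phi>2 t))"
    unfolding local_parametrisation_eventually_iff[OF lp2, of "\<lambda>x. x = \<Phi>1 (\<theta> x)"]
    using \<Phi>1(3,4) homeomorphism_apply2[OF \<Phi>1(5)] by (intro exI[of _ V]) auto
  ultimately show thesis by (rule that)
qed

text \<open>A nonzero derivative makes h biholomorphic from a small disc \<open>A\<close> onto its
  image. That image corresponds to a relatively open part of X, which is cut out by shrinking V to
  \<open>V \<inter> T\<close>.\<close>

lemma local_parametrisation_reparametrise:
  assumes lp: "local_parametrisation X a b \<Phi>"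
    and h: "h holomorphic_on S" "open S" "c \<in> S" "h c = b" "deriv h c \<noteq> 0"
  shows "local_parametrisation X a c (\<lambda>t. \<Phi> (h t))"
proof -
  obtain W V \<theta> where \<Phi>: "\<Phi> b = a" "open W" "b \<in> W" "open V" "a \<in> V"
    "\<And>i. (\<lambda>t. \<Phi> t $ i) holomorphic_on W" "homeomorphism W (X \<inter> V) \<Phi> \<theta>"
    "holomorphic_on_subset \<theta> (X \<inter> V)"
    using lp unfolding local_parametrisation_def by blast
  define S0 where "S0 = S \<inter> h -` W"
  have "open S0"
    unfolding S0_def using h(1,2) \<Phi>(2) by (intro continuous_open_preimage holomorphic_on_imp_continuous_on)
  moreover have "h holomorphic_on S0" "c \<in> S0"
    using h(1,3,4) \<Phi>(3) holomorphic_on_subset[of h S S0] by (auto simp: S0_def)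
  ultimately obtain r where r: "r > 0" "ball c r \<subseteq> S0" "inj_on h (ball c r)"
    using has_complex_derivative_locally_injective[of h S0 c] h(5) by metis
  define A where "A = ball c r"
  have A: "open A" "c \<in> A" "inj_on h A" "A \<subseteq> S" "h ` A \<subseteq> W"
    using r by (auto simp: A_def S0_def)
  have holA: "h holomorphic_on A"
    using h(1) A(4) by (rule holomorphic_on_subset)
  have openB: "open (h ` A)"
    using holA A(1,3) by (rule open_mapping_thm3)
  obtain k where k: "k holomorphic_on (h ` A)" "\<And>z. z \<in> A \<Longrightarrow> k (h z) = z"
    using holomorphic_has_inverse[OF holA A(1,3)] by metis
  have "openin (top_of_set W) (h ` A)"
    using openB A(5) by (rule open_subset[rotated])
  then have "openin (top_of_set (X \<inter> V)) (\<Phi> ` h ` A)"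
    by (rule homeomorphism_imp_open_map[OF \<Phi>(7)])
  then obtain T where T: "open T" "\<Phi> ` h ` A = X \<inter> V \<inter> T"
    unfolding openin_open by blast
  have T': "\<Phi> ` h ` A = X \<inter> (V \<inter> T)"
    using T(2) by auto
  have "a \<in> \<Phi> ` h ` A"
    using A(2) h(4) \<Phi>(1) by auto
  then have aT: "a \<in> V \<inter> T"
    unfolding T' by blast
  have hom: "homeomorphism A (h ` A) h k"
    using holA k by (intro homeomorphismI) (auto intro: holomorphic_on_imp_continuous_on)
  have hom2: "homeomorphism (h ` A) (X \<inter> (V \<inter> T)) \<Phi> \<theta>"
    using homeomorphism_of_subsets[OF \<Phi>(7) A(5) subset_refl T'] .
  have "homeomorphism A (X \<inter> (V \<inter> T)) (\<lambda>t. \<Phi> (h t)) (\<lambda>x. k (\<theta> x))"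
    using homeomorphism_compose[OF hom hom2] by (simp add: o_def)
  moreover have "holomorphic_on_subset (\<lambda>x. k (\<theta> x)) (X \<inter> (V \<inter> T))"
  proof (rule holomorphic_on_subset_compose[OF _ k(1) openB])
    show "holomorphic_on_subset \<theta> (X \<inter> (V \<inter> T))"
      using \<Phi>(8) by (rule holomorphic_on_subset_mono) auto
    show "\<theta> ` (X \<inter> (V \<inter> T)) \<subseteq> h ` A"
      using homeomorphism_image2[OF hom2] by simp
  qed
  moreover have "(\<lambda>t. \<Phi> (h t) $ i) holomorphic_on A" for i
    using holomorphic_on_compose_gen[OF holA \<Phi>(6)[of i] A(5)] by (simp add: o_def)
  ultimately show ?thesis
    unfolding local_parametrisation_def using A(1,2) aT \<Phi>(1,4) T(1) h(4) by blast
qed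

text \<open>Near \<open>b2\<close> the second parametrisation is the first after the transition map,
  so \<open>fps_expansion_compose_vanishing\<close> applies.\<close>

lemma expansion_vanishing_transfer:
  assumes lp1: "local_parametrisation X a b1 \<Phi>1" and lp2: "local_parametrisation X a b2 \<Phi>2"
    and "a \<in> X" and ana: "(\<lambda>t. f (\<Phi>1 t)) analytic_on {b1}"
    and van: "\<And>i. i < k \<Longrightarrow> fps_nth (fps_expansion (\<lambda>t. f (\<Phi>1 t)) b1) i = 0"
    and "i < k"
  shows "fps_nth (fps_expansion (\<lambda>t. f (\<Phi>2 t)) b2) i = 0"
proof -
  obtain h where h: "h analytic_on {b2}" "h b2 = b1" "\<forall>\<^sub>F t in nhds b2. \<Phi>2 t = \<Phi>1 (h t)"
    by (rule transition_map[OF lp1 lp2 \<open>a \<in> X\<close>])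
  have "\<forall>\<^sub>F t in nhds b2. f (\<Phi>2 t) = f (\<Phi>1 (h t))"
    using h(3) by eventually_elim simp
  moreover have "fps_nth (fps_expansion (\<lambda>t. f (\<Phi>1 (h t))) b2) i = 0"
    using fps_expansion_compose_vanishing[of "\<lambda>t. f (\<Phi>1 t)" h b2 k i] h(1,2) ana van \<open>i < k\<close>
    by simp
  ultimately show ?thesis
    using fps_expansion_cong[of "\<lambda>t. f (\<Phi>2 t)" "\<lambda>t. f (\<Phi>1 (h t))" b2] by simp
qed

text \<open>If the k-th coefficient vanished for the second parametrisation, transferring back with
  bound k + 1 would annihilate it for the first one too.\<close>

lemma vanishes_exactly_transfer:
  assumes lp1: "local_parametrisation X a b1 \<Phi>1" and lp2: "local_parametrisation X a b2 \<Phi>2"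
    and "a \<in> X" and ana1: "(\<lambda>t. f (\<Phi>1 t)) analytic_on {b1}"
    and ana2: "(\<lambda>t. f (\<Phi>2 t)) analytic_on {b2}"
    and van: "vanishes_exactly k (\<lambda>t. f (\<Phi>1 t)) b1"
  shows "vanishes_exactly k (\<lambda>t. f (\<Phi>2 t)) b2"
proof -
  have below: "fps_nth (fps_expansion (\<lambda>t. f (\<Phi>2 t)) b2) j = 0" if "j < k" for j
    by (rule expansion_vanishing_transfer[OF lp1 lp2 \<open>a \<in> X\<close> ana1 _ that])
       (use van in \<open>auto simp: vanishes_exactly_def\<close>)
  moreover have "fps_nth (fps_expansion (\<lambda>t. f (\<Phi>2 t)) b2) k \<noteq> 0"
  proof
    assume "fps_nth (fps_expansion (\<lambda>t. f (\<Phi>2 t)) b2) k = 0"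
    then have "fps_nth (fps_expansion (\<lambda>t. f (\<Phi>2 t)) b2) j = 0" if "j < Suc k" for j
      using below that by (auto simp: less_Suc_eq)
    then have "fps_nth (fps_expansion (\<lambda>t. f (\<Phi>1 t)) b1) k = 0"
      by (rule expansion_vanishing_transfer[OF lp2 lp1 \<open>a \<in> X\<close> ana2]) auto
    then show False using van by (simp add: vanishes_exactly_def)
  qed
  ultimately show ?thesis
    by (simp add: vanishes_exactly_def)
qed

section \<open>Polynomials along a parametrisation\<close>

lemma finite_multi_indices: "finite {\<alpha> :: 'm::finite \<Rightarrow> nat. (\<Sum>i\<in>UNIV. \<alpha> i) \<le> d}"
proof (rule finite_subset)
  show "{\<alpha> :: 'm \<Rightarrow> nat. (\<Sum>i\<in>UNIV. \<alpha> i) \<le> d} \<subseteq> (\<Pi>\<^sub>E i\<in>UNIV. {..d})"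
  proof
    fix \<alpha> :: "'m \<Rightarrow> nat" assume "\<alpha> \<in> {\<alpha>. (\<Sum>i\<in>UNIV. \<alpha> i) \<le> d}"
    then have "\<alpha> i \<le> d" for i
      using member_le_sum[of i UNIV \<alpha>] by auto
    then show "\<alpha> \<in> (\<Pi>\<^sub>E i\<in>UNIV. {..d})" by auto
  qed
qed (intro finite_PiE; simp)

lemma polynomials_upto_closed:
  assumes "p \<in> polynomials_upto d" "q \<in> polynomials_upto d"
  shows "(\<lambda>x. p x + c * q x) \<in> polynomials_upto d"
proof -
  obtain u v where "p = (\<lambda>x. \<Sum>\<alpha>\<in>{\<alpha>. (\<Sum>i\<in>UNIV. \<alpha> i) \<le> d}. u \<alpha> * (\<Prod>i\<in>UNIV. (x $ i) ^ \<alpha> i))"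
    "q = (\<lambda>x. \<Sum>\<alpha>\<in>{\<alpha>. (\<Sum>i\<in>UNIV. \<alpha> i) \<le> d}. v \<alpha> * (\<Prod>i\<in>UNIV. (x $ i) ^ \<alpha> i))"
    using assms unfolding polynomials_upto_def by blast
  then show ?thesis
    unfolding polynomials_upto_def
    by (intro range_eqI[of _ _ "\<lambda>\<alpha>. u \<alpha> + c * v \<alpha>"])
       (simp add: sum.distrib sum_distrib_left algebra_simps)
qed

lemma monomial_mem_polynomials_upto:
  assumes "(\<Sum>i\<in>UNIV. \<alpha> i) \<le> d"
  shows "(\<lambda>x. \<Prod>i\<in>UNIV. (x $ i) ^ \<alpha> i) \<in> polynomials_upto d"
  unfolding polynomials_upto_def
proof (rule range_eqI[of _ _ "\<lambda>\<beta>. if \<beta> = \<alpha> then 1 else 0"], rule ext)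
  fix x :: "(complex, 'a) vec"
  let ?A = "{\<alpha> :: 'a \<Rightarrow> nat. (\<Sum>i\<in>UNIV. \<alpha> i) \<le> d}"
  have "(\<Sum>\<beta>\<in>?A. (if \<beta> = \<alpha> then 1 else 0) * (\<Prod>i\<in>UNIV. (x $ i) ^ \<beta> i)) =
        (\<Sum>\<beta>\<in>?A. if \<beta> = \<alpha> then \<Prod>i\<in>UNIV. (x $ i) ^ \<alpha> i else 0)"
    by (intro sum.cong) auto
  then show "(\<Prod>i\<in>UNIV. (x $ i) ^ \<alpha> i) =
      (\<Sum>\<beta>\<in>?A. (if \<beta> = \<alpha> then 1 else 0) * (\<Prod>i\<in>UNIV. (x $ i) ^ \<beta> i))"
    using assms by (simp add: finite_multi_indices)
qed

lemma analytic_pullback_polynomial: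
  fixes \<Phi> :: "complex \<Rightarrow> (complex, 'm::finite) vec"
  assumes "local_parametrisation X a b \<Phi>" "p \<in> polynomials_upto d"
  shows "(\<lambda>t. p (\<Phi> t)) analytic_on {b}"
proof -
  obtain W where W: "open W" "b \<in> W" "\<And>i. (\<lambda>t. \<Phi> t $ i) holomorphic_on W"
    using assms(1) unfolding local_parametrisation_def by blast
  have "(\<lambda>t. p (\<Phi> t)) holomorphic_on W"
    using assms(2) W(3) by (auto simp: polynomials_upto_def intro!: holomorphic_intros)
  then show ?thesis
    using W by (auto simp: analytic_at)
qed

lemma germ_space_pullback_polynomials:
  fixes \<Phi> :: "complex \<Rightarrow> (complex, 'm::finite) vec"
  assumes lp: "local_parametrisation X a b \<Phi>"
  shows "germ_space (pullback_polynomials d \<Phi>) b"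
proof
  show "f analytic_on {b}" if "f \<in> pullback_polynomials d \<Phi>" for f
    using that analytic_pullback_polynomial[OF lp] by (auto simp: pullback_polynomials_def o_def)
  show "(\<lambda>_. 1) \<in> pullback_polynomials d \<Phi>"
    using monomial_mem_polynomials_upto[of "\<lambda>_ :: 'm. 0" d]
    by (auto simp: pullback_polynomials_def o_def)
  show "(\<lambda>t. f t + c * g t) \<in> pullback_polynomials d \<Phi>"
    if fg: "f \<in> pullback_polynomials d \<Phi>" "g \<in> pullback_polynomials d \<Phi>" for f g c
  proof -
    obtain p q where "p \<in> polynomials_upto d" "q \<in> polynomials_upto d" "f = p \<circ> \<Phi>" "g = q \<circ> \<Phi>"
      using fg unfolding pullback_polynomials_def by blast
    then show ?thesis
      using polynomials_upto_closed[of p d q c]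
      by (auto simp: pullback_polynomials_def o_def intro!: image_eqI[of _ _ "\<lambda>x. p x + c * q x"])
  qed
  define A where "A = {\<alpha> :: 'm \<Rightarrow> nat. (\<Sum>i\<in>UNIV. \<alpha> i) \<le> d}"
  define m where "m \<alpha> t = (\<Prod>i\<in>UNIV. (\<Phi> t $ i) ^ \<alpha> i)" for \<alpha> t
  have finA: "finite A"
    unfolding A_def by (rule finite_multi_indices)
  show "\<exists>B. finite B \<and> B \<subseteq> pullback_polynomials d \<Phi> \<and>
      (\<forall>f\<in>pullback_polynomials d \<Phi>. \<exists>c. f = (\<lambda>t. \<Sum>g\<in>B. c g * g t))"
  proof (intro exI[of _ "m ` A"] conjI ballI)
    show "m ` A \<subseteq> pullback_polynomials d \<Phi>"
      unfolding pullback_polynomials_def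
    proof (rule image_subsetI)
      fix \<alpha> assume "\<alpha> \<in> A"
      then show "m \<alpha> \<in> (\<lambda>F. F \<circ> \<Phi>) ` polynomials_upto d"
        by (intro image_eqI[OF _ monomial_mem_polynomials_upto[of \<alpha> d]])
           (auto simp: A_def m_def fun_eq_iff)
    qed
    fix f assume "f \<in> pullback_polynomials d \<Phi>"
    then obtain u where f: "f = (\<lambda>t. \<Sum>\<alpha>\<in>A. u \<alpha> * m \<alpha> t)"
      by (auto simp: pullback_polynomials_def polynomials_upto_def A_def m_def o_def)
    \<comment> \<open>Distinct multi-indices can have the same pull-back, so their coefficients are
      collected.\<close>
    define c where "c g = (\<Sum>\<alpha>\<in>{\<alpha>\<in>A. m \<alpha> = g}. u \<alpha>)" for g
    have "f t = (\<Sum>g\<in>m ` A. c g * g t)" for t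
    proof -
      have "f t = (\<Sum>g\<in>m ` A. \<Sum>\<alpha>\<in>{\<alpha>\<in>A. m \<alpha> = g}. u \<alpha> * m \<alpha> t)"
        unfolding f using finA by (rule sum.image_gen)
      also have "\<dots> = (\<Sum>g\<in>m ` A. c g * g t)"
        unfolding c_def sum_distrib_right by (intro sum.cong) auto
      finally show ?thesis .
    qed
    then show "\<exists>c. f = (\<lambda>t. \<Sum>g\<in>m ` A. c g * g t)" by blast
  qed (use finA in simp)
qed

section \<open>Taylor projectors and reparametrisation\<close>

text \<open>The exponents are orders of polynomials along X, which do not depend on the parameter.
  Exchanging the parametrisations gives equality.\<close>

lemma exponents_subset:
  fixes \<Phi>1 \<Phi>2 :: "complex \<Rightarrow> (complex, 'm::finite) vec"
  assumes lp1: "local_parametrisation X a b1 \<Phi>1" and lp2: "local_parametrisation X a b2 \<Phi>2"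
    and "a \<in> X"
  shows "germ_space.exponents (pullback_polynomials d \<Phi>1) b1
         \<subseteq> germ_space.exponents (pullback_polynomials d \<Phi>2) b2"
proof -
  interpret Z1: germ_space "pullback_polynomials d \<Phi>1" b1
    using lp1 by (rule germ_space_pullback_polynomials)
  interpret Z2: germ_space "pullback_polynomials d \<Phi>2" b2
    using lp2 by (rule germ_space_pullback_polynomials)
  show ?thesis
  proof
    fix k assume "k \<in> Z1.exponents"
    then obtain p where p: "p \<in> polynomials_upto d" "vanishes_exactly k (\<lambda>t. p (\<Phi>1 t)) b1"
      unfolding Z1.exponents_def by (auto simp: pullback_polynomials_def o_def)
    have "vanishes_exactly k (\<lambda>t. p (\<Phi>2 t)) b2"
      using vanishes_exactly_transfer[OF lp1 lp2 \<open>a \<in> X\<close> _ _ p(2)]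
        analytic_pullback_polynomial[OF lp1 p(1)] analytic_pullback_polynomial[OF lp2 p(1)] by blast
    then show "k \<in> Z2.exponents"
      using p unfolding Z2.exponents_def by (auto simp: pullback_polynomials_def o_def)
  qed
qed

definition taylor_condition ::
    "nat \<Rightarrow> complex \<Rightarrow> (complex \<Rightarrow> (complex, 'm::finite) vec) \<Rightarrow>
     ((complex, 'm) vec \<Rightarrow> complex) set \<Rightarrow> ((complex, 'm) vec \<Rightarrow> complex) set \<Rightarrow> bool" where
  "taylor_condition d b \<Phi> \<gamma> \<pi> \<longleftrightarrow>
     (\<forall>f\<in>\<gamma>. \<forall>p\<in>\<pi>. \<forall>q\<in>least_space b (pullback_polynomials d \<Phi>).
        taylor_pairing b q (\<lambda>t. f (\<Phi> t) - p (\<Phi> t)) = 0)"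

lemma taylor_projector_eq:
  "taylor_projector X a d b \<Phi> =
     restrict (\<lambda>\<gamma>. THE \<pi>. \<pi> \<in> polynomial_germs d X a \<and> taylor_condition d b \<Phi> \<gamma> \<pi>)
       (holomorphic_germs X a)"
  by (simp add: taylor_projector_def taylor_condition_def)

lemma self_mem_germ: "f \<in> germ X a f"
  by (auto simp: germ_def intro: exI[of _ UNIV])

lemma mem_germ_iff:
  assumes "local_parametrisation X a b \<Phi>"
  shows "g \<in> germ X a f \<longleftrightarrow> (\<forall>\<^sub>F t in nhds b. g (\<Phi> t) = f (\<Phi> t))"
  unfolding local_parametrisation_eventually_iff[OF assms, of "\<lambda>x. g x = f x"] germ_def by simp

lemma germ_eq_iff:
  assumes lp: "local_parametrisation X a b \<Phi>"
  shows "germ X a f = germ X a g \<longleftrightarrow> (\<forall>\<^sub>F t in nhds b. f (\<Phi> t) = g (\<Phi> t))"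
proof
  assume "germ X a f = germ X a g"
  then show "\<forall>\<^sub>F t in nhds b. f (\<Phi> t) = g (\<Phi> t)"
    using self_mem_germ mem_germ_iff[OF lp] by blast
next
  assume eq: "\<forall>\<^sub>F t in nhds b. f (\<Phi> t) = g (\<Phi> t)"
  have "u \<in> germ X a f \<longleftrightarrow> u \<in> germ X a g" for u
    unfolding mem_germ_iff[OF lp] by (rule eventually_subst) (use eq in \<open>eventually_elim, simp\<close>)
  then show "germ X a f = germ X a g" by blast
qed

text \<open>Representatives of the same germ on X have pull-backs that agree near b, so one pair of
  representatives decides.\<close>

lemma taylor_condition_germ_iff:
  fixes \<Phi> :: "complex \<Rightarrow> (complex, 'm::finite) vec"
  assumes lp: "local_parametrisation X a b \<Phi>"
  shows "taylor_condition d b \<Phi> (germ X a f) (germ X a p) \<longleftrightarrow>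
    (\<forall>e\<in>germ_space.exponents (pullback_polynomials d \<Phi>) b.
       fps_nth (fps_expansion (\<lambda>t. f (\<Phi> t) - p (\<Phi> t)) b) e = 0)"
proof -
  interpret germ_space "pullback_polynomials d \<Phi>" b
    using lp by (rule germ_space_pullback_polynomials)
  have cong: "fps_expansion (\<lambda>t. f' (\<Phi> t) - p' (\<Phi> t)) b = fps_expansion (\<lambda>t. f (\<Phi> t) - p (\<Phi> t)) b"
    if "f' \<in> germ X a f" "p' \<in> germ X a p" for f' p'
    using that unfolding mem_germ_iff[OF lp]
    by (intro fps_expansion_cong) (auto elim: eventually_elim2)
  show ?thesis
    unfolding taylor_condition_def taylor_pairing_zero_iff
  proof
    assume "\<forall>f\<in>germ X a f. \<forall>p\<in>germ X a p. \<forall>e\<in>exponents. coef (\<lambda>t. f (\<Phi> t) - p (\<Phi> t)) e = 0"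
    then show "\<forall>e\<in>exponents. coef (\<lambda>t. f (\<Phi> t) - p (\<Phi> t)) e = 0"
      using self_mem_germ by blast
  next
    assume "\<forall>e\<in>exponents. coef (\<lambda>t. f (\<Phi> t) - p (\<Phi> t)) e = 0"
    then show "\<forall>f\<in>germ X a f. \<forall>p\<in>germ X a p. \<forall>e\<in>exponents. coef (\<lambda>t. f (\<Phi> t) - p (\<Phi> t)) e = 0"
      by (simp add: cong)
  qed
qed

text \<open>Existence is \<open>interpolation\<close>, uniqueness is \<open>expansion_eq_0I\<close>;
  this makes the \<open>THE\<close> in the projector meaningful.\<close>

lemma taylor_projection_unique:
  fixes \<Phi> :: "complex \<Rightarrow> (complex, 'm::finite) vec"
  assumes lp: "local_parametrisation X a b \<Phi>" and f: "(\<lambda>t. f (\<Phi> t)) analytic_on {b}"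
  shows "\<exists>!\<pi>. \<pi> \<in> polynomial_germs d X a \<and> taylor_condition d b \<Phi> (germ X a f) \<pi>"
proof -
  interpret germ_space "pullback_polynomials d \<Phi>" b
    using lp by (rule germ_space_pullback_polynomials)
  have cond: "taylor_condition d b \<Phi> (germ X a f) (germ X a p) \<longleftrightarrow>
      (\<forall>e\<in>exponents. coef (\<lambda>t. p (\<Phi> t)) e = coef (\<lambda>t. f (\<Phi> t)) e)"
    if "p \<in> polynomials_upto d" for p
    using analytic_pullback_polynomial[OF lp that] f
    by (auto simp: taylor_condition_germ_iff[OF lp] fps_expansion_diff)
  show ?thesis
  proof (rule ex_ex1I)
    obtain g where g: "g \<in> pullback_polynomials d \<Phi>" "\<forall>e\<in>exponents. coef g e = coef (\<lambda>t. f (\<Phi> t)) e"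
      using interpolation[of "coef (\<lambda>t. f (\<Phi> t))"] by blast
    then obtain p where p: "p \<in> polynomials_upto d" "g = (\<lambda>t. p (\<Phi> t))"
      by (auto simp: pullback_polynomials_def o_def)
    then have "taylor_condition d b \<Phi> (germ X a f) (germ X a p)"
      using cond g(2) by simp
    then show "\<exists>\<pi>. \<pi> \<in> polynomial_germs d X a \<and> taylor_condition d b \<Phi> (germ X a f) \<pi>"
      using p(1) unfolding polynomial_germs_def by blast
  next
    fix \<pi> \<rho>
    assume A: "\<pi> \<in> polynomial_germs d X a \<and> taylor_condition d b \<Phi> (germ X a f) \<pi>"
      "\<rho> \<in> polynomial_germs d X a \<and> taylor_condition d b \<Phi> (germ X a f) \<rho>"
    then obtain p q where pq: "p \<in> polynomials_upto d" "\<pi> = germ X a p"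
      "q \<in> polynomials_upto d" "\<rho> = germ X a q"
      unfolding polynomial_germs_def by blast
    define u where "u t = p (\<Phi> t) + (-1) * q (\<Phi> t)" for t
    have Z: "(\<lambda>t. p (\<Phi> t)) \<in> pullback_polynomials d \<Phi>" "(\<lambda>t. q (\<Phi> t)) \<in> pullback_polynomials d \<Phi>"
      using pq by (auto simp: pullback_polynomials_def o_def)
    have uZ: "u \<in> pullback_polynomials d \<Phi>"
      unfolding u_def using Z by (rule closed)
    have "coef u e = 0" if "e \<in> exponents" for e
      using A cond[OF pq(1)] cond[OF pq(3)] that unfolding u_def coef_closed[OF Z] pq by simp
    with uZ have "fps_expansion u b = 0" by (rule expansion_eq_0I)
    then have "\<forall>\<^sub>F t in nhds b. u t = 0"
      using fps_expansion_eq_0_iff[OF analytic[OF uZ]] by simp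
    then have "\<forall>\<^sub>F t in nhds b. p (\<Phi> t) = q (\<Phi> t)"
      by eventually_elim (simp add: u_def)
    then show "\<pi> = \<rho>"
      unfolding pq using germ_eq_iff[OF lp] by blast
  qed
qed

lemma gap_free_imp_taylorian:
  fixes \<Phi> :: "complex \<Rightarrow> (complex, 'm::finite) vec"
  assumes lp: "local_parametrisation X a b \<Phi>" and "a \<in> X"
    and gap_free: "gap_free (least_space b (pullback_polynomials d \<Phi>))"
  shows "taylorian X a d"
proof -
  interpret germ_space "pullback_polynomials d \<Phi>" b
    using lp by (rule germ_space_pullback_polynomials)
  define n where "n = card exponents"
  have E: "exponents = {..<n}"
    using gap_free unfolding gap_free_iff n_def .
  have E': "germ_space.exponents (pullback_polynomials d \<Psi>) c = {..<n}"
    if "local_parametrisation X a c \<Psi>" for c \<Psi>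
    using exponents_subset[OF lp that \<open>a \<in> X\<close>, of d]
      exponents_subset[OF that lp \<open>a \<in> X\<close>, of d] E by blast
  have transfer: "taylor_condition d b2 \<Phi>2 (germ X a f) (germ X a p)"
    if lp1: "local_parametrisation X a b1 \<Phi>1" and lp2: "local_parametrisation X a b2 \<Phi>2"
      and f: "(\<lambda>t. f (\<Phi>1 t)) analytic_on {b1}" and p: "p \<in> polynomials_upto d"
      and cond: "taylor_condition d b1 \<Phi>1 (germ X a f) (germ X a p)"
    for b1 \<Phi>1 b2 \<Phi>2 f p
  proof -
    have ana: "(\<lambda>t. f (\<Phi>1 t) - p (\<Phi>1 t)) analytic_on {b1}"
      using f analytic_pullback_polynomial[OF lp1 p] by (intro analytic_intros)
    have "fps_nth (fps_expansion (\<lambda>t. f (\<Phi>1 t) - p (\<Phi>1 t)) b1) i = 0" if "i < n" for i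
      using cond that unfolding taylor_condition_germ_iff[OF lp1] E'[OF lp1] by simp
    then show ?thesis
      using expansion_vanishing_transfer[OF lp1 lp2 \<open>a \<in> X\<close>, of "\<lambda>x. f x - p x" n] ana
      unfolding taylor_condition_germ_iff[OF lp2] E'[OF lp2] by blast
  qed
  have "taylor_projector X a d b1 \<Phi>1 = taylor_projector X a d b2 \<Phi>2"
    if lp1: "local_parametrisation X a b1 \<Phi>1" and lp2: "local_parametrisation X a b2 \<Phi>2"
    for b1 \<Phi>1 b2 \<Phi>2
    unfolding taylor_projector_eq
  proof (rule restrict_ext)
    fix \<gamma> assume "\<gamma> \<in> holomorphic_germs X a"
    then obtain f V where f: "\<gamma> = germ X a f" "open V" "a \<in> V" "holomorphic_on_subset f (X \<inter> V)"
      unfolding holomorphic_germs_def by blast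
    have ana: "(\<lambda>t. f (\<Phi>1 t)) analytic_on {b1}" "(\<lambda>t. f (\<Phi>2 t)) analytic_on {b2}"
      using analytic_pullback[OF _ f(4,2,3) \<open>a \<in> X\<close>] lp1 lp2 by blast+
    have "(\<pi> \<in> polynomial_germs d X a \<and> taylor_condition d b1 \<Phi>1 \<gamma> \<pi>) \<longleftrightarrow>
          (\<pi> \<in> polynomial_germs d X a \<and> taylor_condition d b2 \<Phi>2 \<gamma> \<pi>)" for \<pi>
      using transfer[OF lp1 lp2 ana(1)] transfer[OF lp2 lp1 ana(2)]
      unfolding f(1) polynomial_germs_def by blast
    then show "(THE \<pi>. \<pi> \<in> polynomial_germs d X a \<and> taylor_condition d b1 \<Phi>1 \<gamma> \<pi>) =
               (THE \<pi>. \<pi> \<in> polynomial_germs d X a \<and> taylor_condition d b2 \<Phi>2 \<gamma> \<pi>)"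
      by simp
  qed
  then show ?thesis
    unfolding taylorian_def by blast
qed

section \<open>Detecting a gap by a change of parameter\<close>

lemma fps_nth_one_plus_X_power_1: "fps_nth ((1 + fps_X) ^ k :: complex fps) 1 = of_nat k"
  by (induction k) (simp_all add: fps_mult_nth_1 fps_nth_power_0)

text \<open>
  If \<open>k\<close> is not an exponent but \<open>k + 1\<close> is, then a function on the curve whose pull-back is
  \<open>(t - b)^k\<close> is projected to 0. After the substitution of \<open>t + (t - b)^2\<close> for \<open>t\<close>, its
  pull-back has the coefficient \<open>k \<noteq> 0\<close> at the exponent \<open>k + 1\<close>, and it is not projected to 0.
\<close>
lemma taylorian_imp_gap_free:
  fixes \<Phi> :: "complex \<Rightarrow> (complex, 'm::finite) vec"
  assumes lp: "local_parametrisation X a b \<Phi>" and "a \<in> X" and taylorian: "taylorian X a d"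
  shows "gap_free (least_space b (pullback_polynomials d \<Phi>))"
proof -
  interpret germ_space "pullback_polynomials d \<Phi>" b
    using lp by (rule germ_space_pullback_polynomials)
  show ?thesis
  proof (rule gap_freeI, rule ccontr)
    fix k assume k: "Suc k \<in> exponents" "k \<notin> exponents"
    \<comment> \<open>The contradiction will be that the coefficient k is zero; constants make 0 an
      exponent and so exclude k = 0.\<close>
    have "k \<noteq> 0"
      using k(2) zero_exponent by metis
    define h where "h t = t + (t - b) ^ 2" for t
    define \<Psi> where "\<Psi> t = \<Phi> (h t)" for t
    have "(h has_field_derivative 1) (at b)"
      unfolding h_def by (auto intro!: derivative_eq_intros)
    then have "deriv h b \<noteq> 0"
      using DERIV_imp_deriv by fastforce
    moreover have "h holomorphic_on UNIV"
      unfolding h_def by (intro holomorphic_intros)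
    ultimately have lp': "local_parametrisation X a b \<Psi>"
      unfolding \<Psi>_def using local_parametrisation_reparametrise[OF lp, of h UNIV b]
      by (simp add: h_def)
    obtain W V \<theta> where \<Phi>: "b \<in> W" "open W" "open V" "a \<in> V" "homeomorphism W (X \<inter> V) \<Phi> \<theta>"
      "holomorphic_on_subset \<theta> (X \<inter> V)"
      using lp unfolding local_parametrisation_def by blast
    \<comment> \<open>Since \<theta> inverts \<Phi>, the function \<open>\<theta> x - b\<close> is
      the local coordinate on X, and f pulls back to \<open>(t - b) ^ k\<close> near b.\<close>
    define f where "f x = (\<theta> x - b) ^ k" for x
    have holf: "holomorphic_on_subset f (X \<inter> V)"
      unfolding f_def
      by (rule holomorphic_on_subset_compose[OF \<Phi>(6), of "\<lambda>z. (z - b) ^ k" UNIV])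
         (auto intro!: holomorphic_intros)
    then have germ: "germ X a f \<in> holomorphic_germs X a"
      unfolding holomorphic_germs_def using \<Phi>(3,4) by blast
    have ana: "(\<lambda>t. f (\<Phi> t)) analytic_on {b}" "(\<lambda>t. f (\<Psi> t)) analytic_on {b}"
      using analytic_pullback[OF _ holf \<Phi>(3,4) \<open>a \<in> X\<close>] lp lp' by blast+
    have zero: "(\<lambda>_. 0) \<in> (polynomials_upto d :: ((complex, 'm) vec \<Rightarrow> complex) set)"
      unfolding polynomials_upto_def by (intro range_eqI[of _ _ "\<lambda>_. 0"]) simp
    then have zero_germ: "germ X a (\<lambda>_. 0) \<in> polynomial_germs d X a"
      unfolding polynomial_germs_def by blast
    have near: "\<forall>\<^sub>F t in nhds b. f (\<Phi> t) = (t - b) ^ k"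
      using eventually_nhds_in_open[OF \<Phi>(2,1)]
      by eventually_elim (simp add: f_def homeomorphism_apply1[OF \<Phi>(5)])
    have "coef (\<lambda>t. f (\<Phi> t)) e = 0" if "e \<in> exponents" for e
      using that k(2) fps_expansion_cong[OF near] by (auto simp: fps_expansion_power_shift)
    then have "taylor_condition d b \<Phi> (germ X a f) (germ X a (\<lambda>_. 0))"
      unfolding taylor_condition_germ_iff[OF lp] by simp
    then have "taylor_projector X a d b \<Phi> (germ X a f) = germ X a (\<lambda>_. 0)"
      unfolding taylor_projector_eq restrict_apply'[OF germ]
      using taylor_projection_unique[OF lp ana(1)] zero_germ by (intro the1_equality) auto
    moreover have "taylor_projector X a d b \<Phi> = taylor_projector X a d b \<Psi>"
      using taylorian lp lp' unfolding taylorian_def by blast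
    ultimately have "taylor_projector X a d b \<Psi> (germ X a f) = germ X a (\<lambda>_. 0)"
      by simp
    then have "(THE \<pi>. \<pi> \<in> polynomial_germs d X a \<and> taylor_condition d b \<Psi> (germ X a f) \<pi>) =
        germ X a (\<lambda>_. 0)"
      unfolding taylor_projector_eq restrict_apply'[OF germ] .
    then have "taylor_condition d b \<Psi> (germ X a f) (germ X a (\<lambda>_. 0))"
      using theI'[OF taylor_projection_unique[OF lp' ana(2), of d]] by simp
    \<comment> \<open>By invariance of the exponents, the condition for \<Psi> also tests the index
      k + 1.\<close>
    moreover have "Suc k \<in> germ_space.exponents (pullback_polynomials d \<Psi>) b"
      using k(1) exponents_subset[OF lp lp' \<open>a \<in> X\<close>] by blast
    ultimately have vanish: "coef (\<lambda>t. f (\<Psi> t)) (Suc k) = 0"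
      unfolding taylor_condition_germ_iff[OF lp'] by simp
    have "isCont h b"
      using \<open>(h has_field_derivative 1) (at b)\<close> by (rule DERIV_isCont)
    then have "filterlim h (nhds b) (nhds b)"
      using tendsto_at_iff_tendsto_nhds[of h b] by (simp add: isCont_def h_def)
    with near have "\<forall>\<^sub>F t in nhds b. f (\<Psi> t) = (h t - b) ^ k"
      unfolding \<Psi>_def by (rule eventually_compose_filterlim)
    \<comment> \<open>Here \<open>h t - b\<close> factors as t - b times 1 + (t - b). The
      coefficient at k + 1 is therefore the linear coefficient of
      \<open>(1 + fps_X) ^ k\<close>.\<close>
    then have "\<forall>\<^sub>F t in nhds b. f (\<Psi> t) = (t - b) ^ k * (1 + (t - b)) ^ k"
      by eventually_elim
         (simp add: h_def power2_eq_square algebra_simps flip: power_mult_distrib)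
    then have "fps_expansion (\<lambda>t. f (\<Psi> t)) b = fps_expansion (\<lambda>t. (t - b) ^ k * (1 + (t - b)) ^ k) b"
      by (rule fps_expansion_cong)
    also have "\<dots> = fps_X ^ k * (1 + fps_X) ^ k"
    proof (rule fps_expansion_eqI_shifted)
      show "(\<lambda>x. (b + x - b) ^ k * (1 + (b + x - b)) ^ k) has_fps_expansion fps_X ^ k * (1 + fps_X) ^ k"
        by (auto intro!: fps_expansion_intros)
    qed (intro analytic_intros)
    finally have "coef (\<lambda>t. f (\<Psi> t)) (Suc k) = of_nat k"
      by (simp add: fps_X_power_mult_nth fps_nth_one_plus_X_power_1 flip: One_nat_def)
    then show False
      using vanish \<open>k \<noteq> 0\<close> by simp
  qed
qed

theorem theorem11p1:
  fixes U X :: "(complex, 'm::finite) vec set" and a :: "(complex, 'm) vec"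
    and \<Phi> :: "complex \<Rightarrow> (complex, 'm) vec" and b :: complex and W :: "complex set" and d :: nat
  assumes "open U" and "a \<in> U" and "complex_submanifold 1 U X" and "a \<in> X"
    and "local_parametrisation X a b \<Phi>"
    and "representing_neighbourhood (pullback_polynomials d \<Phi>) b W"
  shows "(bundle_point (pullback_polynomials d \<Phi>) b W \<longleftrightarrow>
            gap_free (least_space b (pullback_polynomials d \<Phi>))) \<and>
         (gap_free (least_space b (pullback_polynomials d \<Phi>)) \<longleftrightarrow>
            closed_under_derivative (least_space b (pullback_polynomials d \<Phi>))) \<and>
         (gap_free (least_space b (pullback_polynomials d \<Phi>)) \<longleftrightarrow> taylorian X a d)"
proof -
  interpret germ_space "pullback_polynomials d \<Phi>" b
    using assms(5) by (rule germ_space_pullback_polynomials)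
  show ?thesis
    using bundle_point_iff_gap_free[OF assms(6)] gap_free_iff_closed_under_derivative
      gap_free_imp_taylorian[OF assms(5,4)] taylorian_imp_gap_free[OF assms(5,4)] by blast
qed

end
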